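(* Suppose there is a constant $c_1>0$ such that for every sufficiently large integer $n$ there exists an $n$-vertex graph of girth more than $8$ with $c_1 n^{5/4}$ edges. Then there is a constant $c_2>0$ such that for all sufficiently large $t$, \[ R(t,B_4)\ge \left(\frac{c_2 t}{\sqrt{\log t}}\right)^{16/13}. \]
   Context: A $3$-graph is a hypergraph all of whose edges have size $3$. An independent set in a hypergraph is a set of vertices containing no edge. For $k\ge 2$, a Berge $k$-cycle is a family of sets $e_1,\dots,e_k$ such that the sets $e_1\cap e_2, e_2\cap e_3,\dots,e_{k-1}\cap e_k, e_k\cap e_1$ have a system of distinct representatives (no non-triviality condition is imposed). $B_k$ denotes the family of all Berge $k$-cycles all of whose sets have size $3$. For a family $\mathcal{F}$ of $3$-graphs, $R(t,\mathcal{F})$ is the minimum $n$ such that every $n$-vertex $3$-graph contains either a member of $\mathcal{F}$ or an independent set of size $t$. Here $\log$ denotes the natural logarithm. *)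

theory Defs
  imports Complex_Main "HOL-Library.Extended_Nat"
begin

type_synonym 'a hgraph = "'a set \<times> 'a set set"

abbreviation verts :: "'a hgraph \<Rightarrow> 'a set" where "verts \<equiv> fst"
abbreviation edges :: "'a hgraph \<Rightarrow> 'a set set" where "edges \<equiv> snd"

(* For r = 2 these are the finite simple graphs. *)
definition uniform_hgraph :: "nat \<Rightarrow> 'a hgraph \<Rightarrow> bool" where
  "uniform_hgraph r H \<longleftrightarrow> finite (verts H) \<and> (\<forall>e\<in>edges H. e \<subseteq> verts H \<and> card e = r)"

definition independent_set :: "'a hgraph \<Rightarrow> 'a set \<Rightarrow> bool" where
  "independent_set H S \<longleftrightarrow> S \<subseteq> verts H \<and> (\<forall>e\<in>edges H. \<not> e \<subseteq> S)"

definition contains_copy :: "'a hgraph \<Rightarrow> 'b hgraph \<Rightarrow> bool" where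
  "contains_copy H F \<longleftrightarrow>
     (\<exists>\<phi>. inj_on \<phi> (verts F) \<and> \<phi> ` verts F \<subseteq> verts H \<and> (\<lambda>e. \<phi> ` e) ` edges F \<subseteq> edges H)"

definition graph_cycle :: "'a hgraph \<Rightarrow> 'a list \<Rightarrow> bool" where
  "graph_cycle G p \<longleftrightarrow> length p \<ge> 3 \<and> distinct p \<and>
     (\<forall>i<length p. {p ! i, p ! (Suc i mod length p)} \<in> edges G)"

(* The infimum is taken in enat, so an acyclic graph has girth \<infinity>. *)
definition girth :: "'a hgraph \<Rightarrow> enat" where
  "girth G = (INF p\<in>{p. graph_cycle G p}. enat (length p))"

(* The sets e 0, ..., e (k - 1) are pairwise distinct, as usual for Berge cycles; with
   repetitions allowed, a single edge would already be a Berge 2-cycle. *)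
definition berge_cycle :: "nat \<Rightarrow> (nat \<Rightarrow> 'a set) \<Rightarrow> bool" where
  "berge_cycle k e \<longleftrightarrow> inj_on e {..<k} \<and>
     (\<exists>v. inj_on v {..<k} \<and> (\<forall>i<k. v i \<in> e i \<inter> e (Suc i mod k)))"

definition berge_family :: "nat \<Rightarrow> nat hgraph set" where
  "berge_family k =
     {(\<Union>i<k. e i, e ` {..<k}) | e. berge_cycle k e \<and> (\<forall>i<k. card (e i) = 3)}"

(* Every finite hypergraph is isomorphic to one with vertices in nat, so letting H range over
   nat hgraph loses nothing. For F = berge_family k the minimum exists by Ramsey's theorem
   for triples. *)
definition ramsey_number :: "nat \<Rightarrow> nat hgraph set \<Rightarrow> nat" where
  "ramsey_number t \<F> = (LEAST n. \<forall>H :: nat hgraph.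
     uniform_hgraph 3 H \<and> card (verts H) = n \<longrightarrow>
       (\<exists>F\<in>\<F>. contains_copy H F) \<or> (\<exists>S. independent_set H S \<and> card S = t))"

end

theory Submission
  imports Defs "HOL-Number_Theory.Number_Theory" "HOL-Real_Asymp.Real_Asymp" "HOL-Library.Ramsey"
begin

text \<open>
  Pass to a subgraph of girth more than \<open>8\<close> with \<open>N\<close> vertices and minimum degree above
  \<open>m \<approx> N\<^sup>1\<^sup>/\<^sup>4\<close>. Neighbourhoods of vertices meet in at most one vertex and form no Berge cycle of length
  at most \<open>4\<close>; trimming and cutting them gives at most \<open>2N\<close> blocks of size at most \<open>m\<close>, with every vertex
  in exactly \<open>m\<close> blocks. The triangles of a \<open>C\<^sub>4\<close>-free graph form a \<open>3\<close>-graph without Berge \<open>4\<close>-cycle, so a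
  random copy of such a triangle system, with about \<open>m\<^sup>3\<^sup>/\<^sup>2\<close> triples, can be placed inside every
  block independently. A set meeting a block in \<open>s\<close> vertices contains a triple of the block with
  probability at least of order \<open>min(1, s\<^sup>3 / m\<^sup>3\<^sup>/\<^sup>2)\<close>. The Moore bound shows that only a small
  part of the incidences of a set of size \<open>t\<close> lies in blocks that it meets in \<open>m / log N\<close> or more vertices,
  and the remaining blocks make the probability of independence smaller than \<open>N\<^sup>-\<^sup>t\<close> as soon as
  \<open>t\<close> exceeds a constant times \<open>m\<^sup>1\<^sup>3\<^sup>/\<^sup>4 (log m)\<^sup>1\<^sup>/\<^sup>2\<close>.
\<close>

text \<open>The exponent comes from a balance. For \<open>N\<close> about \<open>m ^ 4\<close>, a
  set of size \<open>t\<close> meets a block in about \<open>t * m / N\<close> vertices on average.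
  If all intersections had that size, the expected number of triples inside the set, of order
  \<open>N * (t * m / N) ^ 3 / m powr (3/2)\<close>, would exceed \<open>t * ln N\<close> once
  \<open>t ^ 2\<close> exceeds a constant times \<open>m powr (13/2) * ln m\<close>; with
  \<open>N\<close> at least \<open>m ^ 4\<close> this is the exponent 16/13. The obstacle is
  concentration: however many vertices of a block are used, its hitting probability stays at most 1,
  so incidences piled up on few blocks are wasted. Large girth therefore serves twice: it confines
  Berge 4-cycles to single blocks, and it excludes this piling up. The triangles live in a graph on
  \<open>q ^ 2\<close> points, with \<open>q\<close> prime of order \<open>sqrt m\<close>; hence the
  need for primes in intervals of bounded ratio. Three random points form a triangle with
  probability of order \<open>1 / q ^ 3\<close>, the source of the factor
  \<open>m powr (-3/2)\<close> above. The hitting probability is bounded below by a second moment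
  computation.\<close>

section \<open>Primes in short intervals\<close>

text \<open>Passing from \<open>n\<close> to \<open>Suc n\<close> raises \<open>n div d\<close> by 1
  exactly for the divisors \<open>d\<close> of \<open>Suc n\<close>, whose \<open>mangoldt\<close>
  values sum to \<open>ln (Suc n)\<close>. The free upper limit \<open>M\<close> lets the three
  factorials of a binomial coefficient share one range of summation.\<close>

lemma ln_fact_eq_sum_mangoldt:
  assumes "n \<le> M"
  shows "ln (fact n :: real) = (\<Sum>d=1..M. mangoldt d * real (n div d))"
  using assms
proof (induction n)
  case (Suc n)
  have div: "real (Suc n div d) = real (n div d) + (if d dvd Suc n then 1 else 0)" for d
    by (simp add: div_Suc dvd_eq_mod_eq_0)
  have "(\<Sum>d=1..M. mangoldt d * real (Suc n div d)) =
      (\<Sum>d=1..M. mangoldt d * real (n div d)) + (\<Sum>d=1..M. if d dvd Suc n then mangoldt d else 0)"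
    unfolding div sum.distrib[symmetric] by (intro sum.cong) (auto simp: algebra_simps)
  also have "(\<Sum>d=1..M. if d dvd Suc n then mangoldt d else 0) = (\<Sum>d | d dvd Suc n. mangoldt d :: real)"
  proof (rule sum.mono_neutral_cong_right)
    have "d \<le> Suc n" "d > 0" if "d dvd Suc n" for d
      using that by (auto intro: dvd_imp_le Nat.gr0I)
    then show "{d. d dvd Suc n} \<subseteq> {1..M}"
      using Suc.prems by (metis (mono_tags, lifting) One_nat_def Suc_leI atLeastAtMost_iff le_trans mem_Collect_eq subsetI)
  qed auto
  also have "\<dots> = ln (real (Suc n))"
    using mangoldt_sum[of "Suc n", where 'a = real] by simp
  finally show ?case
    using Suc by (simp add: ln_mult del: of_nat_Suc)
qed auto

definition chebyshev_psi :: "nat \<Rightarrow> real" where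
  "chebyshev_psi n = (\<Sum>d=1..n. mangoldt d)"

lemma ln_binomial_eq_sum_mangoldt:
  "ln (real ((a + b) choose a)) =
     (\<Sum>d=1..a+b. mangoldt d * (real ((a + b) div d) - real (a div d) - real (b div d)))"
proof -
  have "real ((a + b) choose a) = fact (a + b) / (fact a * fact b)"
    by (subst binomial_fact) auto
  then have "ln (real ((a + b) choose a)) = ln (fact (a + b)) - ln (fact a) - ln (fact b)"
    by (simp add: ln_div ln_mult)
  also have "\<dots> = (\<Sum>d=1..a+b. mangoldt d * real ((a + b) div d))
      - (\<Sum>d=1..a+b. mangoldt d * real (a div d)) - (\<Sum>d=1..a+b. mangoldt d * real (b div d))"
    by (simp only: ln_fact_eq_sum_mangoldt[of _ "a + b"] le_add1 le_add2 order_refl)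
  finally show ?thesis
    by (simp add: algebra_simps sum_subtractf sum.distrib)
qed

lemma div_add_bounds:
  fixes a b d :: nat
  shows "a div d + b div d \<le> (a + b) div d" "(a + b) div d \<le> a div d + b div d + 1"
proof -
  have "(a + b) div d = a div d + b div d + (a mod d + b mod d) div d"
    by (rule div_add1_eq)
  moreover have "(a mod d + b mod d) div d \<le> 1"
  proof (cases "d = 0")
    case False
    then have "a mod d + b mod d < 2 * d"
      using mod_less_divisor[of d a] mod_less_divisor[of d b] by linarith
    then have "(a mod d + b mod d) div d < 2"
      by (simp add: div_less_iff_less_mult False)
    then show ?thesis
      by simp
  qed auto
  ultimately show "a div d + b div d \<le> (a + b) div d" "(a + b) div d \<le> a div d + b div d + 1"
    by auto
qed

lemma ln_binomial_le_psi: "ln (real ((a + b) choose a)) \<le> chebyshev_psi (a + b)"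
  unfolding ln_binomial_eq_sum_mangoldt chebyshev_psi_def
proof (rule sum_mono)
  fix d
  have "real ((a + b) div d) - real (a div d) - real (b div d) \<le> 1"
    using div_add_bounds(2)[of a b d] by linarith
  then show "mangoldt d * (real ((a + b) div d) - real (a div d) - real (b div d)) \<le> mangoldt d"
    using mult_left_mono[OF _ mangoldt_nonneg] by fastforce
qed

text \<open>For \<open>d\<close> in \<open>{b+1..b+a}\<close> both \<open>a div d\<close> and
  \<open>b div d\<close> vanish while \<open>(a + b) div d\<close> is positive, so
  \<open>mangoldt d\<close> has coefficient at least 1 in the expansion of the binomial; all other
  coefficients are nonnegative.\<close>

lemma psi_diff_le_ln_binomial:
  assumes "a \<le> b"
  shows "chebyshev_psi (a + b) \<le> chebyshev_psi b + ln (real ((a + b) choose a))"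
proof -
  have "(\<Sum>d=b+1..b+a. mangoldt d :: real) \<le>
      (\<Sum>d=b+1..b+a. mangoldt d * (real ((a + b) div d) - real (a div d) - real (b div d)))"
  proof (rule sum_mono)
    fix d assume d: "d \<in> {b+1..b+a}"
    then have "a div d = 0" "b div d = 0"
      using assms by auto
    moreover have "(a + b) div d \<ge> 1"
      using d by (simp add: Suc_le_eq div_greater_zero_iff)
    ultimately show "mangoldt d \<le> mangoldt d * (real ((a + b) div d) - real (a div d) - real (b div d))"
      using mult_left_mono[of 1 "real ((a + b) div d)" "mangoldt d"] mangoldt_nonneg[of d] by simp
  qed
  also have "\<dots> \<le> (\<Sum>d=1..a+b. mangoldt d * (real ((a + b) div d) - real (a div d) - real (b div d)))"
  proof (rule sum_mono2)
    fix d
    have "real (a div d) + real (b div d) \<le> real ((a + b) div d)"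
      using div_add_bounds(1)[of a d b] by linarith
    then show "0 \<le> mangoldt d * (real ((a + b) div d) - real (a div d) - real (b div d))"
      by (intro mult_nonneg_nonneg mangoldt_nonneg) auto
  qed auto
  finally have "(\<Sum>d=b+1..b+a. mangoldt d) \<le> ln (real ((a + b) choose a))"
    unfolding ln_binomial_eq_sum_mangoldt .
  moreover have "chebyshev_psi (a + b) = chebyshev_psi b + (\<Sum>d=b+1..b+a. mangoldt d)"
    unfolding chebyshev_psi_def using sum.ub_add_nat[of 1 b mangoldt a] by (simp add: add.commute)
  ultimately show ?thesis
    by simp
qed

text \<open>Induction by halving: \<open>n\<close> is split as \<open>a + b\<close> with
  \<open>a = n div 2\<close>, and the binomial coefficient is at most \<open>4 ^ a\<close>. For odd
  \<open>n\<close> this holds because the two equal middle coefficients together are at most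
  \<open>2 ^ n\<close>.\<close>

lemma chebyshev_psi_le: "chebyshev_psi n \<le> real n * ln 4"
proof (induction n rule: less_induct)
  case (less n)
  show ?case
  proof (cases "n \<le> 1")
    case True
    then have "n = 0 \<or> n = 1"
      by auto
    then show ?thesis
      by (auto simp: chebyshev_psi_def)
  next
    case False
    define a where "a = n div 2"
    define b where "b = n - a"
    have ab: "a + b = n" "a \<le> b" "b < n" "n = 2 * a \<or> n = 2 * a + 1"
      using False by (auto simp: a_def b_def)
    have "n choose a \<le> 4 ^ a"
    proof (cases "n = 2 * a")
      case True
      have "n choose a \<le> 2 ^ n"
        by (rule binomial_le_pow2)
      then show ?thesis
        using True by (simp add: power_mult)
    next
      case False
      then have n: "n = 2 * a + 1"
        using ab by auto
      have "2 * (n choose a) = (n choose a) + (n choose Suc a)"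
        using n binomial_symmetric[of a n] by simp
      also have "\<dots> = (\<Sum>k\<in>{a, Suc a}. n choose k)"
        by simp
      also have "\<dots> \<le> (\<Sum>k\<le>n. n choose k)"
        using n by (intro sum_mono2) auto
      also have "\<dots> = 2 ^ n"
        by (rule choose_row_sum)
      also have "\<dots> = 2 * 4 ^ a"
        using n by (simp add: power_mult)
      finally show ?thesis
        by simp
    qed
    then have "real (n choose a) \<le> real (4 ^ a)"
      by (simp only: of_nat_le_iff)
    then have "ln (real (n choose a)) \<le> ln (4 ^ a)"
      using ab by (subst ln_le_cancel_iff) auto
    also have "\<dots> = real a * ln 4"
      by (simp add: ln_realpow)
    finally have "chebyshev_psi n \<le> chebyshev_psi b + real a * ln 4"
      using psi_diff_le_ln_binomial[OF ab(2)] ab(1) by simp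
    also have "\<dots> \<le> real b * ln 4 + real a * ln 4"
      using less ab by simp
    also have "\<dots> = real n * ln 4"
      using ab(1) by (metis of_nat_add distrib_right add.commute)
    finally show ?thesis .
  qed
qed

lemma chebyshev_psi_ge:
  assumes "n > 0"
  shows "real n * ln 4 - ln (2 * real n) \<le> chebyshev_psi (2 * n)"
proof -
  have "real n * ln 4 - ln (2 * real n) = ln (4 ^ n / (2 * real n))"
    using assms by (simp add: ln_div ln_realpow)
  also have "\<dots> \<le> ln (real ((2 * n) choose n))"
    using assms central_binomial_lower_bound[OF assms] by (subst ln_le_cancel_iff) auto
  also have "\<dots> \<le> chebyshev_psi (2 * n)"
    using ln_binomial_le_psi[of n n] by (simp add: mult_2)
  finally show ?thesis .
qed

text \<open>Without primes in the interval only powers \<open>p ^ k\<close> with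
  \<open>k \<ge> 2\<close> contribute. Then \<open>p\<close> is at most \<open>sqrt N\<close> and
  \<open>k\<close> at most \<open>log 2 N\<close>, and each such power contributes at most
  \<open>ln N\<close>.\<close>

lemma psi_diff_le_if_no_prime:
  assumes "\<And>p. prime p \<Longrightarrow> x < p \<Longrightarrow> p \<le> N \<Longrightarrow> False" "x \<le> N" "N > 1"
  shows "chebyshev_psi N - chebyshev_psi x \<le> sqrt N * log 2 N * ln N"
proof -
  define D where "D = {d \<in> {x+1..N}. primepow d}"
  define R where "R = {1..nat \<lfloor>sqrt N\<rfloor>}"
  define K where "K = {1..nat \<lfloor>log 2 N\<rfloor>}"
  have "D \<subseteq> (\<lambda>(p, k). p ^ k) ` (R \<times> K)"
  proof
    fix d assume d: "d \<in> D"
    then obtain p k where pk: "prime p" "k > 0" "d = p ^ k"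
      unfolding D_def primepow_def by auto
    have "k \<noteq> 1"
      using assms(1)[of p] d pk by (auto simp: D_def)
    with pk have k2: "k \<ge> 2"
      by auto
    have p1: "p \<ge> 2"
      using pk prime_ge_2_nat by auto
    have "p ^ 2 \<le> p ^ k"
      using k2 p1 by (intro power_increasing) auto
    then have "p ^ 2 \<le> N"
      using d pk by (auto simp: D_def)
    then have "real p ^ 2 \<le> real N"
      by (metis of_nat_le_iff of_nat_power)
    then have "real p \<le> sqrt N"
      by (rule real_le_rsqrt)
    then have "p \<in> R"
      using p1 unfolding R_def by (auto simp: le_nat_iff le_floor_iff)
    moreover have "k \<in> K"
    proof -
      have "2 ^ k \<le> p ^ k"
        using p1 by (intro power_mono) auto
      also have "\<dots> \<le> N"
        using d pk by (auto simp: D_def)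
      finally have "2 ^ k \<le> N" .
      then have "k \<le> log 2 N"
        by (simp add: le_log2_of_power)
      then show ?thesis
        using k2 unfolding K_def by (auto simp: le_nat_iff le_floor_iff)
    qed
    ultimately show "d \<in> (\<lambda>(p, k). p ^ k) ` (R \<times> K)"
      using pk by auto
  qed
  then have "card D \<le> card (R \<times> K)"
    by (rule surj_card_le[rotated]) (auto simp: R_def K_def)
  then have "real (card D) \<le> real (card R) * real (card K)"
    by (simp add: card_cartesian_product flip: of_nat_mult)
  also have "\<dots> \<le> sqrt N * log 2 N"
    using assms(3) by (intro mult_mono) (auto simp: R_def K_def)
  finally have cardD: "real (card D) \<le> sqrt N * log 2 N" .
  have "chebyshev_psi N = chebyshev_psi x + (\<Sum>d=x+1..N. mangoldt d)"
    unfolding chebyshev_psi_def using sum.ub_add_nat[of 1 x mangoldt "N - x"] assms(2) by simp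
  also have "(\<Sum>d=x+1..N. mangoldt d :: real) = (\<Sum>d\<in>D. mangoldt d)"
    by (rule sum.mono_neutral_right) (auto simp: D_def mangoldt_def)
  also have "\<dots> \<le> (\<Sum>d\<in>D. ln N)"
  proof (rule sum_mono)
    fix d assume "d \<in> D"
    then have "mangoldt d \<le> ln d" "ln d \<le> ln N"
      by (auto simp: D_def intro: mangoldt_le)
    then show "mangoldt d \<le> ln N"
      by linarith
  qed
  also have "\<dots> \<le> sqrt N * log 2 N * ln N"
    using mult_right_mono[OF cardD, of "ln N"] assms(3) by simp
  finally show ?thesis
    by simp
qed

text \<open>The factor 4 is what the two elementary bounds can separate: the main terms are
  \<open>2 * x * ln 4\<close> for \<open>chebyshev_psi (4 * x)\<close> and \<open>x * ln 4\<close>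
  for \<open>chebyshev_psi x\<close>. At the factor 2 they would cancel.\<close>

lemma eventually_prime_between:
  "\<forall>\<^sub>F x in sequentially. \<exists>p. prime p \<and> x < p \<and> p \<le> 4 * x"
proof -
  have "\<forall>\<^sub>F x::nat in sequentially.
      sqrt (4 * real x) * log 2 (4 * real x) * ln (4 * real x) < real x * ln 4 - ln (4 * real x)"
    by real_asymp
  then show ?thesis
    using eventually_gt_at_top[of 1]
  proof eventually_elim
    case (elim x)
    show ?case
    proof (rule ccontr)
      assume "\<not> ?thesis"
      then have "chebyshev_psi (4 * x) - chebyshev_psi x \<le> sqrt (4 * x) * log 2 (4 * x) * ln (4 * x)"
        using elim by (intro psi_diff_le_if_no_prime) auto
      moreover have "chebyshev_psi (4 * x) \<ge> 2 * real x * ln 4 - ln (4 * real x)"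
        using chebyshev_psi_ge[of "2 * x"] elim by (simp add: mult.assoc)
      moreover have "chebyshev_psi x \<le> real x * ln 4"
        by (rule chebyshev_psi_le)
      ultimately show False
        using elim by simp
    qed
  qed
qed

section \<open>Graphs of large girth\<close>

text \<open>A shortest closed segment of the walk is a cycle: length 1 contradicts edges having two
  elements, length 2 contradicts \<open>nonbacktracking\<close>, and minimality makes its vertices
  distinct. The condition \<open>nonbacktracking\<close> does not reach across the seam from
  \<open>x (n - 1)\<close> to \<open>x 1\<close>; a tail there is cut off by passing to the
  segment.\<close>

lemma girth_le_if_closed_walk:
  assumes G: "uniform_hgraph 2 G"
    and walk: "\<And>k. k < n \<Longrightarrow> {x k, x (Suc k)} \<in> edges G"
    and nonbacktracking: "\<And>k. k + 2 \<le> n \<Longrightarrow> x k \<noteq> x (k + 2)"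
    and "n > 0" "x n = x 0"
  shows "girth G \<le> enat n"
proof -
  define Q where "Q = (\<lambda>l. l > 0 \<and> (\<exists>i. i + l \<le> n \<and> x i = x (i + l)))"
  have "Q n"
    using assms by (auto simp: Q_def)
  define l where "l = (LEAST l. Q l)"
  have "Q l"
    unfolding l_def by (rule LeastI) (fact \<open>Q n\<close>)
  then obtain i where i: "l > 0" "i + l \<le> n" "x i = x (i + l)"
    by (auto simp: Q_def)
  have least: "\<not> Q k" if "k < l" for k
    using that not_less_Least unfolding l_def by blast
  have "l \<noteq> 1"
  proof
    assume "l = 1"
    then have "{x i} \<in> edges G"
      using walk[of i] i by simp
    then show False
      using G by (auto simp: uniform_hgraph_def)
  qed
  moreover have "l \<noteq> 2"
    using nonbacktracking[of i] i by auto
  ultimately have l: "l \<ge> 3"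
    using i by linarith
  define p where "p = map x [i..<i + l]"
  have nth: "p ! k = x (i + k)" if "k < l" for k
    using that by (simp add: p_def)
  have "x (i + a) \<noteq> x (i + b)" if "a < b" "b < l" for a b
  proof
    assume "x (i + a) = x (i + b)"
    then have "Q (b - a)"
      using that i unfolding Q_def by (intro conjI exI[of _ "i + a"]) auto
    then show False
      using least[of "b - a"] that by simp
  qed
  then have "distinct p"
    unfolding distinct_conv_nth using nth by (auto simp: p_def) (metis linorder_neqE_nat)
  moreover have "{p ! k, p ! (Suc k mod length p)} \<in> edges G" if "k < length p" for k
  proof (cases "Suc k = l")
    case True
    then have "{p ! k, p ! (Suc k mod length p)} = {x (i + k), x (Suc (i + k))}"
      using nth[of k] nth[of 0] i by (simp add: p_def flip: add_Suc_right)
    then show ?thesis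
      using walk[of "i + k"] True i by simp
  next
    case False
    then have "{p ! k, p ! (Suc k mod length p)} = {x (i + k), x (Suc (i + k))}"
      using nth[of k] nth[of "Suc k"] that by (simp add: p_def)
    then show ?thesis
      using walk[of "i + k"] that i by (simp add: p_def)
  qed
  ultimately have "graph_cycle G p"
    using l by (auto simp: graph_cycle_def p_def)
  then have "girth G \<le> enat (length p)"
    unfolding girth_def by (auto intro: INF_lower)
  also have "\<dots> \<le> enat n"
    using i by (simp add: p_def)
  finally show ?thesis .
qed

section \<open>Subgraphs of large minimum degree\<close>

lemma card_incident_edges_le:
  assumes "finite W" "\<And>e. e \<in> E \<Longrightarrow> card e = 2"
  shows "card {e \<in> E. e \<subseteq> W \<and> u \<in> e} \<le> card {v \<in> W. {u, v} \<in> E}"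
proof -
  have "{e \<in> E. e \<subseteq> W \<and> u \<in> e} \<subseteq> (\<lambda>v. {u, v}) ` {v \<in> W. {u, v} \<in> E}"
  proof
    fix e assume e: "e \<in> {e \<in> E. e \<subseteq> W \<and> u \<in> e}"
    then obtain a b where "e = {a, b}"
      using assms(2)[of e] by (auto simp: card_2_iff)
    with e show "e \<in> (\<lambda>v. {u, v}) ` {v \<in> W. {u, v} \<in> E}"
      by (auto simp: insert_commute)
  qed
  then show ?thesis
    using assms(1) by (intro surj_card_le) auto
qed

text \<open>Deleting a vertex with at most \<open>D\<close> neighbours loses at most
  \<open>D\<close> edges, so the strict edge bound survives. It fails for the empty set, so the
  deletion stops before that.\<close>

lemma exists_subset_min_degree:
  assumes "finite W" "\<And>e. e \<in> E \<Longrightarrow> card e = 2" "D * card W < card {e \<in> E. e \<subseteq> W}"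
  shows "\<exists>W'\<subseteq>W. W' \<noteq> {} \<and> (\<forall>u\<in>W'. D < card {v \<in> W'. {u, v} \<in> E})"
  using assms(1,3)
proof (induction W rule: finite_psubset_induct)
  case (psubset W)
  have fin: "finite {e \<in> E. e \<subseteq> W}"
    by (rule finite_subset[of _ "Pow W"]) (use psubset.hyps in auto)
  show ?case
  proof (cases "\<exists>u\<in>W. card {v \<in> W. {u, v} \<in> E} \<le> D")
    case True
    then obtain u where u: "u \<in> W" "card {v \<in> W. {u, v} \<in> E} \<le> D"
      by auto
    have "{e \<in> E. e \<subseteq> W} = {e \<in> E. e \<subseteq> W - {u}} \<union> {e \<in> E. e \<subseteq> W \<and> u \<in> e}"
      by auto
    then have "card {e \<in> E. e \<subseteq> W} \<le> card {e \<in> E. e \<subseteq> W - {u}} + card {e \<in> E. e \<subseteq> W \<and> u \<in> e}"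
      using card_Un_le[of "{e \<in> E. e \<subseteq> W - {u}}" "{e \<in> E. e \<subseteq> W \<and> u \<in> e}"] by simp
    also have "\<dots> \<le> card {e \<in> E. e \<subseteq> W - {u}} + D"
      using card_incident_edges_le[of W E u, OF psubset.hyps assms(2)] u by simp
    finally have "D * card W < card {e \<in> E. e \<subseteq> W - {u}} + D"
      using psubset.prems by linarith
    moreover have "card W = Suc (card (W - {u}))"
      by (rule card.remove[OF psubset.hyps u(1)])
    ultimately have "D * card (W - {u}) < card {e \<in> E. e \<subseteq> W - {u}}"
      by simp
    then obtain W' where "W' \<subseteq> W - {u}" "W' \<noteq> {}" "\<forall>u\<in>W'. D < card {v \<in> W'. {u, v} \<in> E}"
      using psubset.IH[of "W - {u}"] u by auto
    then show ?thesis
      by blast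
  next
    case False
    have "W \<noteq> {}"
    proof
      assume "W = {}"
      then have "{e \<in> E. e \<subseteq> W} = {}"
        using assms(2) by fastforce
      then show False
        using psubset.prems by (metis card.empty not_less0)
    qed
    then show ?thesis
      using False by (intro exI[of _ W]) (auto simp: not_le)
  qed
qed

section \<open>Non-backtracking walks and the Moore bound\<close>

definition nb_walks :: "'a set set \<Rightarrow> 'a set \<Rightarrow> 'a \<Rightarrow> nat \<Rightarrow> 'a list set" where
  "nb_walks E W u k = {xs. length xs = Suc k \<and> xs ! 0 = u \<and> set xs \<subseteq> W \<and>
     (\<forall>i<k. {xs ! i, xs ! Suc i} \<in> E) \<and> (\<forall>i. i + 2 \<le> k \<longrightarrow> xs ! i \<noteq> xs ! (i + 2))}"

lemma finite_nb_walks: "finite W \<Longrightarrow> finite (nb_walks E W u k)"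
  by (rule finite_subset[OF _ finite_lists_length_eq[of W "Suc k"]]) (auto simp: nb_walks_def)

lemma card_nb_walks_ge:
  assumes "finite W" "u \<in> W" "\<And>u. u \<in> W \<Longrightarrow> D < card {v \<in> W. {u, v} \<in> E}"
  shows "D ^ k \<le> card (nb_walks E W u k)"
proof (induction k)
  case 0
  have "[u] \<in> nb_walks E W u 0"
    using assms by (auto simp: nb_walks_def)
  then have "card (nb_walks E W u 0) \<noteq> 0"
    using finite_nb_walks[OF assms(1), of E u 0] by auto
  then show ?case
    by simp
next
  case (Suc k)
  \<comment> \<open>For \<open>k = 0\<close> there is no previous vertex and \<open>k - 1\<close> is
    0, so the current vertex is removed instead. At most one vertex is lost either way, which the
    strict degree bound absorbs.\<close>
  define ext where "ext xs = {v \<in> W. {xs ! k, v} \<in> E} - {xs ! (k - 1)}" for xs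
  have ext: "D \<le> card (ext xs)" if "xs \<in> nb_walks E W u k" for xs
  proof -
    have "xs ! k \<in> W"
      using that by (auto simp: nb_walks_def)
    then have "D < card {v \<in> W. {xs ! k, v} \<in> E}"
      by (rule assms(3))
    then show ?thesis
      using diff_card_le_card_Diff[of "{xs ! (k - 1)}" "{v \<in> W. {xs ! k, v} \<in> E}"]
      unfolding ext_def by simp
  qed
  have "D ^ Suc k \<le> (\<Sum>xs\<in>nb_walks E W u k. D)"
    using Suc.IH by (simp add: mult.commute)
  also have "\<dots> \<le> (\<Sum>xs\<in>nb_walks E W u k. card (ext xs))"
    by (intro sum_mono ext)
  also have "\<dots> = card (SIGMA xs:nb_walks E W u k. ext xs)"
    using assms(1) by (intro card_SigmaI[symmetric] finite_nb_walks) (auto simp: ext_def)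
  also have "\<dots> \<le> card (nb_walks E W u (Suc k))"
  proof (rule card_inj_on_le)
    show "inj_on (\<lambda>(xs, v). xs @ [v]) (SIGMA xs:nb_walks E W u k. ext xs)"
      by (auto simp: inj_on_def)
    have "xs @ [v] \<in> nb_walks E W u (Suc k)" if xs: "xs \<in> nb_walks E W u k" and v: "v \<in> ext xs" for xs v
    proof -
      have "{(xs @ [v]) ! i, (xs @ [v]) ! Suc i} \<in> E" if "i < Suc k" for i
        using that xs v by (cases "i = k") (auto simp: nb_walks_def ext_def nth_append)
      moreover have "(xs @ [v]) ! i \<noteq> (xs @ [v]) ! (i + 2)" if "i + 2 \<le> Suc k" for i
        using that xs v by (cases "Suc i = k") (auto simp: nb_walks_def ext_def nth_append)
      moreover have "length (xs @ [v]) = Suc (Suc k)" "(xs @ [v]) ! 0 = u" "set (xs @ [v]) \<subseteq> W"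
        using xs v by (auto simp: nb_walks_def ext_def nth_append)
      ultimately show ?thesis
        unfolding nb_walks_def by blast
    qed
    then show "(\<lambda>(xs, v). xs @ [v]) ` (SIGMA xs:nb_walks E W u k. ext xs) \<subseteq> nb_walks E W u (Suc k)"
      by auto
  qed (rule finite_nb_walks[OF assms(1)])
  finally show ?case .
qed

text \<open>Two different non-backtracking walks of length \<open>k\<close> from \<open>u\<close>
  cannot have the same end: from where they split to where they next meet they would bound a closed
  walk of length at most \<open>2 * k\<close>. So the at least \<open>D ^ k\<close> walks have
  distinct ends in \<open>W\<close>.\<close>

lemma moore_bound:
  assumes G: "uniform_hgraph 2 G" and girth: "girth G > enat (2 * k)"
    and W: "finite W" "W \<noteq> {}" "\<And>u. u \<in> W \<Longrightarrow> D < card {v \<in> W. {u, v} \<in> edges G}"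
  shows "D ^ k \<le> card W"
proof -
  obtain u where u: "u \<in> W"
    using W by auto
  have "inj_on (\<lambda>xs. xs ! k) (nb_walks (edges G) W u k)"
  proof (rule inj_onI, rule ccontr)
    fix xs ys
    assume xs: "xs \<in> nb_walks (edges G) W u k" and ys: "ys \<in> nb_walks (edges G) W u k"
      and eq: "xs ! k = ys ! k" and neq: "xs \<noteq> ys"
    define i where "i = (LEAST i. xs ! i \<noteq> ys ! i)"
    have "\<exists>i. xs ! i \<noteq> ys ! i \<and> i \<le> k"
      using neq xs ys by (auto simp: nb_walks_def list_eq_iff_nth_eq less_Suc_eq_le)
    then obtain i0 where i0: "xs ! i0 \<noteq> ys ! i0" "i0 \<le> k"
      by auto
    have i: "xs ! i \<noteq> ys ! i"
      unfolding i_def by (rule LeastI) (fact i0)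
    have "i \<le> k"
      unfolding i_def using i0 by (meson Least_le order.trans)
    have before: "xs ! a = ys ! a" if "a < i" for a
      using that not_less_Least unfolding i_def by blast
    have "i \<noteq> 0"
      using i xs ys by (metis (mono_tags, lifting) mem_Collect_eq nb_walks_def)
    define j where "j = (LEAST j. i \<le> j \<and> xs ! j = ys ! j)"
    have j: "i \<le> j" "xs ! j = ys ! j"
      unfolding j_def using LeastI[of "\<lambda>j. i \<le> j \<and> xs ! j = ys ! j" k] eq \<open>i \<le> k\<close> by auto
    have "j \<le> k"
      unfolding j_def using eq \<open>i \<le> k\<close> by (intro Least_le) auto
    have between: "xs ! a \<noteq> ys ! a" if "i \<le> a" "a < j" for a
      using that not_less_Least unfolding j_def by blast
    have "i < j"
      using i j by (metis le_neq_implies_less)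
    obtain h where h: "i = Suc h"
      using \<open>i \<noteq> 0\<close> by (auto simp: gr0_conv_Suc)
    define l where "l = j - h"
    have l: "j = h + l" "l \<ge> 2" "h + l \<le> k"
      using h \<open>i < j\<close> \<open>j \<le> k\<close> by (auto simp: l_def)
    \<comment> \<open>Out along \<open>xs\<close> from the last common index \<open>h\<close> to the
      first reunion \<open>j = h + l\<close>, then back along \<open>ys\<close>; both branches agree
      at \<open>a = l\<close>. The turning point \<open>a = l - 1\<close> is the only place where
      the non-backtracking condition compares the two walks, and there they differ by minimality of
      \<open>j\<close>.\<close>
    define z where "z a = (if a \<le> l then xs ! (h + a) else ys ! (h + (2 * l - a)))" for a
    have z2: "z a = ys ! (h + (2 * l - a))" if "l \<le> a" for a
      using that j l by (auto simp: z_def le_less)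
    have nbx: "xs ! a \<noteq> xs ! (a + 2)" "ys ! a \<noteq> ys ! (a + 2)" if "a + 2 \<le> k" for a
      using that xs ys by (auto simp: nb_walks_def)
    have edge: "{xs ! a, xs ! Suc a} \<in> edges G" "{ys ! a, ys ! Suc a} \<in> edges G" if "a < k" for a
      using that xs ys by (auto simp: nb_walks_def)
    have "girth G \<le> enat (2 * l)"
    proof (rule girth_le_if_closed_walk[where x = z])
      fix a assume a: "a < 2 * l"
      show "{z a, z (Suc a)} \<in> edges G"
      proof (cases "a < l")
        case True
        then show ?thesis
          using edge(1)[of "h + a"] l by (simp add: z_def)
      next
        case False
        define b where "b = 2 * l - Suc a"
        have b: "2 * l - a = Suc b" "2 * l - Suc a = b" "h + b < k"
          using a False l by (auto simp: b_def)
        then show ?thesis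
          using edge(2)[of "h + b"] False by (simp add: z2 insert_commute)
      qed
    next
      fix a assume a: "a + 2 \<le> 2 * l"
      consider "a + 2 \<le> l" | "a = l - 1" | "l \<le> a"
        by linarith
      then show "z a \<noteq> z (a + 2)"
      proof cases
        case 1
        then show ?thesis
          using nbx(1)[of "h + a"] l by (simp add: z_def add.assoc)
      next
        case 2
        then have "z a = xs ! (h + l - 1)" "z (a + 2) = ys ! (h + l - 1)"
          using l by (auto simp: z_def Suc_diff_le numeral_2_eq_2 split: if_splits)
        then show ?thesis
          using between[of "h + l - 1"] l h by auto
      next
        case 3
        define b where "b = 2 * l - (a + 2)"
        have b: "2 * l - a = b + 2" "2 * l - (a + 2) = b" "h + b + 2 \<le> k"
          using a 3 l by (auto simp: b_def)
        then show ?thesis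
          using nbx(2)[of "h + b"] 3 by (simp add: z2 add.assoc)
      qed
    next
      show "z (2 * l) = z 0"
        using l before[of h] h by (simp add: z_def)
    qed (use G l in auto)
    also have "\<dots> \<le> enat (2 * k)"
      using l by simp
    finally show False
      using girth by simp
  qed
  moreover have "(\<lambda>xs. xs ! k) ` nb_walks (edges G) W u k \<subseteq> W"
    by (auto simp: nb_walks_def)
  ultimately have "card (nb_walks (edges G) W u k) \<le> card W"
    using W(1) by (intro card_inj_on_le)
  moreover have "D ^ k \<le> card (nb_walks (edges G) W u k)"
    by (rule card_nb_walks_ge) (use W u in auto)
  ultimately show ?thesis
    by simp
qed

text \<open>More edges would yield a nonempty subset with all degrees above \<open>D\<close>, which
  by the Moore bound has at least \<open>D ^ k\<close> vertices.\<close>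

lemma card_induced_edges_le:
  assumes "uniform_hgraph 2 G" "girth G > enat (2 * k)" "finite W" "card W < D ^ k"
  shows "card {e \<in> edges G. e \<subseteq> W} \<le> D * card W"
proof (rule ccontr)
  assume "\<not> ?thesis"
  then obtain W' where W': "W' \<subseteq> W" "W' \<noteq> {}" "\<forall>u\<in>W'. D < card {v \<in> W'. {u, v} \<in> edges G}"
    using exists_subset_min_degree[of W "edges G" D] assms by (auto simp: uniform_hgraph_def not_le)
  then have "D ^ k \<le> card W'"
    using assms by (intro moore_bound[of G]) (auto intro: finite_subset)
  then show False
    using card_mono[OF assms(3) W'(1)] assms(4) by simp
qed

section \<open>Closed chains of neighbourhoods in a graph of girth more than 8\<close>

context
  fixes G :: "'a hgraph"
  assumes G: "uniform_hgraph 2 G" "girth G > 8"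
begin

text \<open>Here and in the two lemmas after it, the \<open>c\<close> are centres of neighbourhoods
  and the \<open>v\<close> are vertices shared by consecutive neighbourhoods; distinctness of
  consecutive \<open>c\<close> and of consecutive \<open>v\<close> is what
  \<open>girth_le_if_closed_walk\<close> asks for.\<close>

lemma no_closed_walk_4:
  assumes "{c0, v0} \<in> edges G" "{v0, c1} \<in> edges G" "{c1, v1} \<in> edges G" "{v1, c0} \<in> edges G"
    and "c0 \<noteq> c1" "v0 \<noteq> v1"
  shows False
proof -
  define x where "x = (!) [c0, v0, c1, v1, c0]"
  have "girth G \<le> enat 4"
  proof (rule girth_le_if_closed_walk[OF G(1), where x = x])
    fix k :: nat
    show "{x k, x (Suc k)} \<in> edges G" if "k < 4"
      using that assms by (auto simp: x_def less_Suc_eq numeral_eq_Suc)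
    show "x k \<noteq> x (k + 2)" if "k + 2 \<le> 4"
    proof -
      have "k = 0 \<or> k = 1 \<or> k = 2"
        using that by linarith
      then show ?thesis
        using assms by (auto simp: x_def numeral_eq_Suc)
    qed
  qed (auto simp: x_def numeral_eq_Suc)
  also have "enat 4 \<le> 8"
    by (simp add: numeral_eq_enat)
  finally show False
    using G(2) by simp
qed

lemma no_closed_walk_6:
  assumes "{c0, v0} \<in> edges G" "{v0, c1} \<in> edges G" "{c1, v1} \<in> edges G" "{v1, c2} \<in> edges G"
    and "{c2, v2} \<in> edges G" "{v2, c0} \<in> edges G"
    and "c0 \<noteq> c1" "c1 \<noteq> c2" "c2 \<noteq> c0" "v0 \<noteq> v1" "v1 \<noteq> v2"
  shows False
proof -
  define x where "x = (!) [c0, v0, c1, v1, c2, v2, c0]"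
  have "girth G \<le> enat 6"
  proof (rule girth_le_if_closed_walk[OF G(1), where x = x])
    fix k :: nat
    show "{x k, x (Suc k)} \<in> edges G" if "k < 6"
      using that assms by (auto simp: x_def less_Suc_eq numeral_eq_Suc)
    show "x k \<noteq> x (k + 2)" if "k + 2 \<le> 6"
    proof -
      have "k = 0 \<or> k = 1 \<or> k = 2 \<or> k = 3 \<or> k = 4"
        using that by linarith
      then show ?thesis
        using assms by (auto simp: x_def numeral_eq_Suc)
    qed
  qed (auto simp: x_def numeral_eq_Suc)
  also have "enat 6 \<le> 8"
    by (simp add: numeral_eq_enat)
  finally show False
    using G(2) by simp
qed

lemma no_closed_walk_8:
  assumes "{c0, v0} \<in> edges G" "{v0, c1} \<in> edges G" "{c1, v1} \<in> edges G" "{v1, c2} \<in> edges G"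
    and "{c2, v2} \<in> edges G" "{v2, c3} \<in> edges G" "{c3, v3} \<in> edges G" "{v3, c0} \<in> edges G"
    and "c0 \<noteq> c1" "c1 \<noteq> c2" "c2 \<noteq> c3" "c3 \<noteq> c0" "v0 \<noteq> v1" "v1 \<noteq> v2" "v2 \<noteq> v3"
  shows False
proof -
  define x where "x = (!) [c0, v0, c1, v1, c2, v2, c3, v3, c0]"
  have "girth G \<le> enat 8"
  proof (rule girth_le_if_closed_walk[OF G(1), where x = x])
    fix k :: nat
    show "{x k, x (Suc k)} \<in> edges G" if "k < 8"
      using that assms by (auto simp: x_def less_Suc_eq numeral_eq_Suc)
    show "x k \<noteq> x (k + 2)" if "k + 2 \<le> 8"
    proof -
      have "k = 0 \<or> k = 1 \<or> k = 2 \<or> k = 3 \<or> k = 4 \<or> k = 5 \<or> k = 6"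
        using that by linarith
      then show ?thesis
        using assms by (auto simp: x_def numeral_eq_Suc)
    qed
  qed (auto simp: x_def numeral_eq_Suc)
  then show False
    using G(2) by (simp add: numeral_eq_enat)
qed

text \<open>Contracting equal consecutive centres leaves a closed walk with two, three or four
  centres, of length 4, 6 or 8, unless all centres coincide. A single inequality cannot occur around
  a cycle.\<close>

lemma neighbourhood_chain_trivial:
  assumes "{c0, v0} \<in> edges G" "{v0, c1} \<in> edges G" "{c1, v1} \<in> edges G" "{v1, c2} \<in> edges G"
    and "{c2, v2} \<in> edges G" "{v2, c3} \<in> edges G" "{c3, v3} \<in> edges G" "{v3, c0} \<in> edges G"
    and "distinct [v0, v1, v2, v3]"
  shows "c0 = c1 \<and> c1 = c2 \<and> c2 = c3"
proof -
  note e = assms(1-8)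
  have ne: "v0 \<noteq> v1" "v0 \<noteq> v2" "v0 \<noteq> v3" "v1 \<noteq> v2" "v1 \<noteq> v3" "v2 \<noteq> v3"
    using assms(9) by auto
  show ?thesis
  proof (cases "c0 = c1"; cases "c1 = c2"; cases "c2 = c3"; cases "c3 = c0")
    assume "c0 \<noteq> c1" "c1 \<noteq> c2" "c2 \<noteq> c3" "c3 \<noteq> c0"
    then show ?thesis
      using no_closed_walk_8[OF e(1-8)] ne by blast
  qed (use e ne no_closed_walk_4 no_closed_walk_6 in \<open>simp; metis\<close>)+
qed

end

section \<open>Block systems from neighbourhoods\<close>

lemma card_ordered_adjacent_pairs_le:
  assumes "finite X" "\<And>e. e \<in> E \<Longrightarrow> card e = 2"
  shows "card {(u, v). u \<in> X \<and> v \<in> X \<and> {u, v} \<in> E} \<le> 2 * card {e \<in> E. e \<subseteq> X}"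
proof -
  define F where "F = {e \<in> E. e \<subseteq> X}"
  have fin: "finite F"
    by (rule finite_subset[of _ "Pow X"]) (use assms in \<open>auto simp: F_def\<close>)
  have pairs: "finite {(u, v). {u, v} = e} \<and> card {(u, v). {u, v} = e} \<le> 2" if "e \<in> F" for e
  proof -
    have "card e = 2"
      using assms(2) that by (simp add: F_def)
    then obtain a b where ab: "e = {a, b}"
      by (auto simp: card_2_iff)
    have "{(u, v). {u, v} = e} \<subseteq> {(a, b), (b, a)}"
      by (auto simp: ab doubleton_eq_iff)
    moreover have "card {x, y} \<le> 2" for x y :: "'a \<times> 'a"
      by (cases "x = y") auto
    ultimately show ?thesis
      using finite_subset[of "{(u, v). {u, v} = e}" "{(a, b), (b, a)}"]
        card_mono[of "{(a, b), (b, a)}" "{(u, v). {u, v} = e}"]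
      by (metis (no_types, lifting) finite.emptyI finite_insert order.trans)
  qed
  have "{(u, v). u \<in> X \<and> v \<in> X \<and> {u, v} \<in> E} \<subseteq> (\<Union>e\<in>F. {(u, v). {u, v} = e})"
    by (auto simp: F_def)
  then have "card {(u, v). u \<in> X \<and> v \<in> X \<and> {u, v} \<in> E} \<le> card (\<Union>e\<in>F. {(u, v). {u, v} = e})"
    using fin pairs by (intro card_mono) auto
  also have "\<dots> \<le> (\<Sum>e\<in>F. card {(u, v). {u, v} = e})"
    by (rule card_UN_le[OF fin])
  also have "\<dots> \<le> (\<Sum>e\<in>F. 2)"
    using pairs by (intro sum_mono) auto
  finally show ?thesis
    by (simp add: F_def mult.commute)
qed

text \<open>This is all that the random construction needs to know about the graph.
  \<open>sparse\<close> is the Moore bound for the incidences between vertices and blocks.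
  \<open>closed_chain_trivial\<close> allows repeated indices, so it also covers chains that only
  partly stay in one block; it forces the representatives of a Berge 4-cycle into a single
  block.\<close>

locale block_system =
  fixes W :: "'a set" and m :: nat and I :: "'i set" and B :: "'i \<Rightarrow> 'a set"
  assumes finite_I: "finite I" and card_I: "card I \<le> 2 * card W"
    and block_subset: "i \<in> I \<Longrightarrow> B i \<subseteq> W"
    and card_block: "i \<in> I \<Longrightarrow> card (B i) \<le> m"
    and sum_card_block: "S \<subseteq> W \<Longrightarrow> (\<Sum>i\<in>I. card (S \<inter> B i)) = m * card S"
    and sparse: "S \<subseteq> W \<Longrightarrow> J \<subseteq> I \<Longrightarrow> card S + card J < D ^ 4 \<Longrightarrow>
      (\<Sum>i\<in>J. card (S \<inter> B i)) \<le> 2 * D * (card S + card J)"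
    and closed_chain_trivial: "distinct [v0, v1, v2, v3] \<Longrightarrow> v0 \<in> B i0 \<inter> B i1 \<Longrightarrow> v1 \<in> B i1 \<inter> B i2 \<Longrightarrow>
      v2 \<in> B i2 \<inter> B i3 \<Longrightarrow> v3 \<in> B i3 \<inter> B i0 \<Longrightarrow> i0 = i1 \<and> i1 = i2 \<and> i2 = i3"

text \<open>Each vertex \<open>u\<close> chooses exactly \<open>m\<close> neighbours
  \<open>P u\<close>, and \<open>C v\<close> collects those who chose \<open>v\<close>. Counting
  from the side of \<open>u\<close> makes the number of incidences exactly \<open>m\<close> per
  vertex, although the sets \<open>C v\<close> have uncontrolled sizes.\<close>

lemma exists_block_system:
  fixes G :: "'a hgraph"
  assumes G: "uniform_hgraph 2 G" "girth G > 8" and W: "finite W" and "m > 0"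
    and deg: "\<And>u. u \<in> W \<Longrightarrow> m \<le> card {v \<in> W. {u, v} \<in> edges G}"
  shows "\<exists>(I :: ('a \<times> nat) set) B. block_system W m I B"
proof -
  have "\<exists>A\<subseteq>{v \<in> W. {u, v} \<in> edges G}. card A = m" if "u \<in> W" for u
    by (rule obtain_subset_with_card_n[OF deg[OF that]]) blast
  then have "\<forall>u\<in>W. \<exists>A. A \<subseteq> {v \<in> W. {u, v} \<in> edges G} \<and> card A = m"
    by blast
  from bchoice[OF this] obtain P
    where "\<forall>u\<in>W. P u \<subseteq> {v \<in> W. {u, v} \<in> edges G} \<and> card (P u) = m" ..
  then have P: "P u \<subseteq> {v \<in> W. {u, v} \<in> edges G}" "card (P u) = m" if "u \<in> W" for u
    using that by blast+
  define C where "C v = {u \<in> W. v \<in> P u}" for v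
  have finC: "finite (C v)" for v
    using W by (simp add: C_def)
  then have "\<exists>f. bij_betw f (C v) {0..<card (C v)}" for v
    by (rule ex_bij_betw_finite_nat)
  then obtain f where f: "\<And>v. bij_betw (f v) (C v) {0..<card (C v)}"
    by metis
  \<comment> \<open>Chosen neighbourhoods may be large, so they are cut into pieces of size at most \<open>m\<close>.\<close>
  define B where "B = (\<lambda>(v, j). {u \<in> C v. f v u div m = j})"
  \<comment> \<open>The upper index is included, so centre \<open>v\<close> owns one block more than
    \<open>card (C v) div m\<close>. The quotients add up to at most \<open>card W\<close>, and the
    additional blocks account for the second \<open>card W\<close>.\<close>
  define I where "I = (SIGMA v:W. {..card (C v) div m})"
  have finI: "finite I"
    using W by (auto simp: I_def)
  have finP: "finite (P u)" if "u \<in> W" for u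
    using P(2)[OF that] \<open>m > 0\<close> by (intro card_ge_0_finite) simp
  have adj: "{u, v} \<in> edges G" "v \<in> W" "u \<in> W" if "u \<in> B (v, j)" for u v j
    using that P(1)[of u] by (auto simp: B_def C_def)
  have count: "(\<Sum>i\<in>I. card (S \<inter> B i)) = m * card S" if S: "S \<subseteq> W" for S
  proof -
    have finS: "finite S"
      using S W by (rule finite_subset)
    have "(\<Sum>i\<in>I. card (S \<inter> B i)) = card (SIGMA i:I. S \<inter> B i)"
      using finI finS by simp
    also have "\<dots> = card (SIGMA u:S. P u)"
    proof (rule bij_betw_same_card)
      have "v \<in> W" "f v u div m \<le> card (C v) div m" if "u \<in> S" "v \<in> P u" for u v
      proof -
        have "u \<in> C v"
          using that S by (auto simp: C_def)
        then have "f v u < card (C v)"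
          using f[of v] by (auto simp: bij_betw_def)
        then show "f v u div m \<le> card (C v) div m"
          by (intro div_le_mono) simp
        show "v \<in> W"
          using that S P(1) by blast
      qed
      then show "bij_betw (\<lambda>(i, u). (u, fst i)) (SIGMA i:I. S \<inter> B i) (SIGMA u:S. P u)"
        using S by (intro bij_betw_byWitness[where f' = "\<lambda>(u, v). ((v, f v u div m), u)"])
          (auto simp: B_def I_def C_def)
    qed
    also have "\<dots> = (\<Sum>u\<in>S. m)"
      using finS S finP P(2) by (subst card_SigmaI) (auto intro!: sum.cong simp del: sum_constant)
    finally show ?thesis
      by (simp add: mult.commute)
  qed
  show ?thesis
  proof (intro exI, unfold_locales)
    show "finite I"
      by (fact finI)
    have "(\<Sum>v\<in>W. card (C v)) = card (SIGMA v:W. C v)"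
      using W finC by simp
    also have "\<dots> = card (SIGMA u:W. P u)"
    proof (rule bij_betw_same_card)
      have "v \<in> W" if "u \<in> W" "v \<in> P u" for u v
        using P(1) that by blast
      then show "bij_betw prod.swap (SIGMA v:W. C v) (SIGMA u:W. P u)"
        by (intro bij_betw_byWitness[where f' = prod.swap]) (auto simp: C_def)
    qed
    also have "\<dots> = m * card W"
      using W finP P(2) by (subst card_SigmaI) (auto simp: mult.commute)
    finally have "(\<Sum>v\<in>W. card (C v)) = m * card W" .
    moreover have "m * (\<Sum>v\<in>W. card (C v) div m) \<le> (\<Sum>v\<in>W. card (C v))"
      by (auto simp: sum_distrib_left intro: sum_mono)
    ultimately have "(\<Sum>v\<in>W. card (C v) div m) \<le> card W"
      using \<open>m > 0\<close> by simp
    moreover have "card I = (\<Sum>v\<in>W. card (C v) div m) + card W"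
      using W by (simp add: I_def sum_Suc)
    ultimately show "card I \<le> 2 * card W"
      by simp
  next
    fix i assume "i \<in> I"
    obtain v j where i: "i = (v, j)"
      by (cases i)
    show "B i \<subseteq> W"
      by (auto simp: i B_def C_def)
    have "card (B i) \<le> card {j * m..<Suc j * m}"
    proof (rule card_inj_on_le)
      show "inj_on (f v) (B i)"
        using f[of v] by (auto simp: i B_def bij_betw_def inj_on_def)
      show "f v ` B i \<subseteq> {j * m..<Suc j * m}"
        using \<open>m > 0\<close> by (auto simp: i B_def dividend_less_div_times div_times_less_eq_dividend add.commute)
    qed auto
    then show "card (B i) \<le> m"
      by simp
  next
    fix S :: "'a set" and J :: "('a \<times> nat) set" and D :: nat
    assume S: "S \<subseteq> W" and J: "J \<subseteq> I" and D: "card S + card J < D ^ 4"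
    \<comment> \<open>Incidences of \<open>S\<close> with blocks of \<open>J\<close> become adjacent
      pairs inside \<open>X\<close>: for a given centre, the vertex determines its piece. Ordered
      pairs are counted because a vertex of \<open>S\<close> may itself be a centre.\<close>
    define X where "X = S \<union> fst ` J"
    have fin: "finite S" "finite J"
      using S W J finI by (auto intro: finite_subset)
    then have finX: "finite X"
      by (simp add: X_def)
    have cardX: "card X \<le> card S + card J"
      unfolding X_def using card_Un_le[of S "fst ` J"] card_image_le[OF fin(2), of fst] by linarith
    have "(\<Sum>i\<in>J. card (S \<inter> B i)) = card (SIGMA i:J. S \<inter> B i)"
      using fin by simp
    also have "\<dots> \<le> card {(u, v). u \<in> X \<and> v \<in> X \<and> {u, v} \<in> edges G}"
    proof (rule card_inj_on_le)
      show "inj_on (\<lambda>(i, u). (u, fst i)) (SIGMA i:J. S \<inter> B i)"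
        by (auto simp: inj_on_def B_def)
      show "(\<lambda>(i, u). (u, fst i)) ` (SIGMA i:J. S \<inter> B i) \<subseteq> {(u, v). u \<in> X \<and> v \<in> X \<and> {u, v} \<in> edges G}"
        using adj by (force simp: X_def)
      show "finite {(u, v). u \<in> X \<and> v \<in> X \<and> {u, v} \<in> edges G}"
        by (rule finite_subset[of _ "X \<times> X"]) (use finX in auto)
    qed
    also have "\<dots> \<le> 2 * card {e \<in> edges G. e \<subseteq> X}"
      using finX G(1) by (intro card_ordered_adjacent_pairs_le) (auto simp: uniform_hgraph_def)
    also have "\<dots> \<le> 2 * (D * card X)"
      using card_induced_edges_le[of G 4 X D] G finX cardX D by (simp add: numeral_eq_enat)
    also have "\<dots> \<le> 2 * D * (card S + card J)"
      using cardX by simp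
    finally show "(\<Sum>i\<in>J. card (S \<inter> B i)) \<le> 2 * D * (card S + card J)" .
  next
    fix i0 i1 i2 i3 v0 v1 v2 v3
    assume v: "distinct [v0, v1, v2, v3]" "v0 \<in> B i0 \<inter> B i1" "v1 \<in> B i1 \<inter> B i2"
      "v2 \<in> B i2 \<inter> B i3" "v3 \<in> B i3 \<inter> B i0"
    have adj': "{u, fst i} \<in> edges G" "{fst i, u} \<in> edges G" if "u \<in> B i" for u i
      using adj(1)[of u "fst i" "snd i"] that by (auto simp: insert_commute)
    have "fst i0 = fst i1 \<and> fst i1 = fst i2 \<and> fst i2 = fst i3"
      by (rule neighbourhood_chain_trivial[OF G, of _ v0 _ v1 _ v2 _ v3]) (use v adj' in auto)
    moreover have "i = i'" if "u \<in> B i \<inter> B i'" "fst i = fst i'" for u i i'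
      using that by (cases i; cases i') (auto simp: B_def)
    ultimately show "i0 = i1 \<and> i1 = i2 \<and> i2 = i3"
      using v by metis
  qed (fact count)
qed

section \<open>A graph without four-cycles and with many triangles\<close>

definition plane :: "nat \<Rightarrow> (int \<times> int) set" where
  "plane q = {0..<int q} \<times> {0..<int q}"

text \<open>The point \<open>b\<close> lies on the line with slope \<open>fst a\<close> and
  intercept \<open>- snd a\<close>, so this is a polarity graph of the affine plane without vertical
  lines. Its loops, for odd \<open>q\<close>, are the points of the parabola
  \<open>2 * y = x ^ 2\<close>.\<close>

definition parab :: "nat \<Rightarrow> int \<times> int \<Rightarrow> int \<times> int \<Rightarrow> bool" where
  "parab q a b \<longleftrightarrow> [snd a + snd b = fst a * fst b] (mod int q)"

text \<open>For pairwise adjacent points of the plane, distinct first coordinates amount to distinct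
  points, by \<open>parab_unique_snd\<close>.\<close>

definition triangle :: "nat \<Rightarrow> int \<times> int \<Rightarrow> int \<times> int \<Rightarrow> int \<times> int \<Rightarrow> bool" where
  "triangle q a b c \<longleftrightarrow> fst a \<noteq> fst b \<and> fst b \<noteq> fst c \<and> fst a \<noteq> fst c \<and>
     parab q a b \<and> parab q b c \<and> parab q a c"

lemma parab_sym: "parab q a b \<longleftrightarrow> parab q b a"
  by (simp add: parab_def add.commute mult.commute)

lemma triangle_rotate: "triangle q a b c \<longleftrightarrow> triangle q b c a"
  using parab_sym by (auto simp: triangle_def)

lemma finite_plane [simp]: "finite (plane q)"
  by (simp add: plane_def)

lemma card_plane: "card (plane q) = q ^ 2"
  by (simp add: plane_def power2_eq_square)

lemma cong_imp_eq:
  assumes "[x = y] (mod int q)" "x \<in> {0..<int q}" "y \<in> {0..<int q}"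
  shows "x = y"
  using assms cong_less_imp_eq_int[of x "int q" y] by auto

lemma parab_unique_snd:
  assumes "parab q a b" "parab q a b'" "b \<in> plane q" "b' \<in> plane q" "fst b = fst b'"
  shows "b = b'"
proof -
  have "[snd a + snd b = snd a + snd b'] (mod int q)"
    using assms unfolding parab_def by (metis cong_sym cong_trans)
  then have "[snd b = snd b'] (mod int q)"
    by (simp add: cong_add_lcancel)
  then have "snd b = snd b'"
    using assms by (intro cong_imp_eq) (auto simp: plane_def)
  then show ?thesis
    using assms by (simp add: prod_eq_iff)
qed

text \<open>The alternating sum of the four adjacency equations is
  \<open>(fst a - fst b) * (fst c - fst d) = 0\<close> modulo \<open>q\<close>.\<close>

lemma parab_no_C4:
  assumes q: "prime q" and U: "a \<in> plane q" "b \<in> plane q" "c \<in> plane q" "d \<in> plane q"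
    and adj: "parab q a c" "parab q a d" "parab q b c" "parab q b d"
  shows "a = b \<or> c = d"
proof (rule disjCI)
  assume "c \<noteq> d"
  have "fst c \<noteq> fst d"
    using \<open>c \<noteq> d\<close> parab_unique_snd[of q a c d] adj U by auto
  have "[(snd a + snd c) - (snd b + snd c) - ((snd a + snd d) - (snd b + snd d)) =
      fst a * fst c - fst b * fst c - (fst a * fst d - fst b * fst d)] (mod int q)"
    using adj unfolding parab_def by (intro cong_diff)
  then have "[(fst a - fst b) * (fst c - fst d) = 0] (mod int q)"
    by (simp add: algebra_simps cong_sym_eq)
  then have "int q dvd (fst a - fst b) * (fst c - fst d)"
    by (simp add: cong_0_iff)
  moreover have "prime (int q)"
    using q by simp
  ultimately have "int q dvd fst a - fst b \<or> int q dvd fst c - fst d"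
    by (meson prime_dvd_mult_iff)
  moreover have "\<not> int q dvd fst c - fst d"
    using \<open>fst c \<noteq> fst d\<close> U cong_imp_eq[of "fst c" "fst d" q] by (auto simp: plane_def cong_iff_dvd_diff)
  ultimately have "fst a = fst b"
    using U cong_imp_eq[of "fst a" "fst b" q] by (auto simp: plane_def cong_iff_dvd_diff)
  then show "a = b"
    using parab_unique_snd[of q c a b] adj U parab_sym by metis
qed

lemma triangle_unique_third:
  assumes "prime q" "a \<in> plane q" "b \<in> plane q" "c \<in> plane q" "d \<in> plane q"
    and "triangle q a b c" "triangle q a b d"
  shows "c = d"
  using parab_no_C4[of q a b c d] assms parab_sym[of q] by (auto simp: triangle_def)

text \<open>Adding two of the three equations and subtracting the third gives
  \<open>2 * snd a\<close> in terms of first coordinates, and 2 is invertible for odd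
  \<open>q\<close>. A triangle thus has only three free coordinates out of six.\<close>

lemma triangle_determined_by_fst:
  assumes q: "prime q" "q > 2"
    and U: "a \<in> plane q" "b \<in> plane q" "c \<in> plane q" "a' \<in> plane q" "b' \<in> plane q" "c' \<in> plane q"
    and tri: "triangle q a b c" "triangle q a' b' c'"
    and "fst a = fst a'" "fst b = fst b'" "fst c = fst c'"
  shows "a = a' \<and> b = b' \<and> c = c'"
proof -
  have *: "x = x'" if tri: "triangle q x y z" "triangle q x' y' z'" and U: "x \<in> plane q" "x' \<in> plane q"
    and eq: "fst x = fst x'" "fst y = fst y'" "fst z = fst z'" for x y z x' y' z'
  proof -
    have "[(snd x + snd y) + (snd x + snd z) - (snd y + snd z) =
        fst x * fst y + fst x * fst z - fst y * fst z] (mod int q)"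
      using tri(1) unfolding triangle_def parab_def by (intro cong_add cong_diff) auto
    moreover have "[(snd x' + snd y') + (snd x' + snd z') - (snd y' + snd z') =
        fst x' * fst y' + fst x' * fst z' - fst y' * fst z'] (mod int q)"
      using tri(2) unfolding triangle_def parab_def by (intro cong_add cong_diff) auto
    ultimately have "[2 * snd x = 2 * snd x'] (mod int q)"
      using eq by (simp add: algebra_simps) (metis cong_sym cong_trans)
    moreover have "coprime 2 (int q)"
      using q by (metis coprime_int_iff of_nat_numeral prime_odd_nat coprime_left_2_iff_odd)
    ultimately have "[snd x = snd x'] (mod int q)"
      by (simp add: cong_mult_lcancel coprime_commute)
    then have "snd x = snd x'"
      using U by (intro cong_imp_eq) (auto simp: plane_def)
    then show ?thesis
      using eq by (simp add: prod_eq_iff)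
  qed
  have "triangle q b c a" "triangle q b' c' a'" "triangle q c a b" "triangle q c' a' b'"
    using tri triangle_rotate by metis+
  then show ?thesis
    using *[OF tri] *[of b c a b' c' a'] *[of c a b c' a' b'] U assms by auto
qed

text \<open>
  The three equations of a triangle are linear in the second coordinates, with determinant \<open>\<plusminus>2\<close>.
\<close>

lemma exists_triangle:
  assumes q: "prime q" "q > 2"
    and x: "x \<in> {0..<int q}" "y \<in> {0..<int q}" "z \<in> {0..<int q}" "x \<noteq> y" "y \<noteq> z" "x \<noteq> z"
  shows "\<exists>a\<in>plane q. \<exists>b\<in>plane q. \<exists>c\<in>plane q. triangle q a b c \<and> fst a = x \<and> fst b = y \<and> fst c = z"
proof -
  \<comment> \<open>The inverse of 2 modulo \<open>q\<close>, since
    \<open>2 * h = int q + 1\<close>.\<close>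
  define h where "h = (int q + 1) div 2"
  have "odd q"
    using q by (simp add: prime_odd_nat)
  then have h: "2 * h = int q + 1"
    by (auto elim!: oddE simp: h_def)
  have key: "[h * (x * y + x * z - y * z) mod int q + h * (y * x + y * z - x * z) mod int q = x * y] (mod int q)"
    for x y z
  proof -
    have "[h * (x * y + x * z - y * z) mod int q + h * (y * x + y * z - x * z) mod int q =
        h * (x * y + x * z - y * z) + h * (y * x + y * z - x * z)] (mod int q)"
      by (intro cong_add) simp_all
    also have "h * (x * y + x * z - y * z) + h * (y * x + y * z - x * z) = (2 * h) * (x * y)"
      by (simp add: algebra_simps)
    also have "\<dots> = int q * (x * y) + x * y"
      unfolding h by (simp add: algebra_simps)
    also have "[\<dots> = x * y] (mod int q)"
      by (simp add: cong_iff_dvd_diff)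
    finally show ?thesis .
  qed
  define a b c where "a = (x, h * (x * y + x * z - y * z) mod int q)"
    and "b = (y, h * (y * x + y * z - x * z) mod int q)"
    and "c = (z, h * (z * x + z * y - x * y) mod int q)"
  have "a \<in> plane q" "b \<in> plane q" "c \<in> plane q"
    using x q by (auto simp: a_def b_def c_def plane_def)
  moreover have "triangle q a b c"
    using x key[of x y z] key[of y z x] key[of x z y]
    by (simp add: triangle_def parab_def a_def b_def c_def algebra_simps)
  ultimately show ?thesis
    by (intro bexI[of _ a] bexI[of _ b] bexI[of _ c]) (auto simp: a_def b_def c_def)
qed

section \<open>Random colourings of a block\<close>

text \<open>Fixing the values on \<open>us\<close> leaves all other values free. Hence an event that
  depends only on the colours of a few vertices can be counted on short lists of colours.\<close>

lemma card_PiE_map: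
  assumes B: "finite B" and U: "finite U" and us: "distinct us" "set us \<subseteq> B"
  shows "card {\<phi> \<in> B \<rightarrow>\<^sub>E U. Q (map \<phi> us)} =
    card {ys. set ys \<subseteq> U \<and> length ys = length us \<and> Q ys} * card U ^ (card B - length us)"
proof -
  define R where "R = {ys. set ys \<subseteq> U \<and> length ys = length us \<and> Q ys}"
  have finR: "finite R"
    by (rule finite_subset[OF _ finite_lists_length_eq[OF U, of "length us"]]) (auto simp: R_def)
  have fin: "finite (B \<rightarrow>\<^sub>E U)"
    using B U by (intro finite_PiE) auto
  have fibre: "card {\<phi> \<in> B \<rightarrow>\<^sub>E U. map \<phi> us = ys} = card U ^ (card B - length us)" if "ys \<in> R" for ys
  proof -
    define g where "g x = the (map_of (zip us ys) x)" for x
    have len: "length ys = length us" and "set ys \<subseteq> U"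
      using that by (auto simp: R_def)
    have g: "g (us ! k) = ys ! k" if "k < length us" for k
      using map_of_zip_nth[of us ys k] that us len by (simp add: g_def)
    have map_eq: "map \<phi> us = ys \<longleftrightarrow> (\<forall>x\<in>set us. \<phi> x = g x)" for \<phi>
      using g len by (auto simp: list_eq_iff_nth_eq in_set_conv_nth) (metis nth_mem)
    have gU: "g x \<in> U" if "x \<in> set us" for x
    proof -
      obtain k where "k < length us" "x = us ! k"
        using \<open>x \<in> set us\<close> by (auto simp: in_set_conv_nth)
      then show ?thesis
        using g len \<open>set ys \<subseteq> U\<close> by (metis nth_mem subsetD)
    qed
    have "{\<phi> \<in> B \<rightarrow>\<^sub>E U. map \<phi> us = ys} = (\<Pi>\<^sub>E x\<in>B. if x \<in> set us then {g x} else U)"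
      unfolding map_eq
    proof (rule subset_antisym; rule subsetI)
      fix \<phi> assume \<phi>: "\<phi> \<in> (\<Pi>\<^sub>E x\<in>B. if x \<in> set us then {g x} else U)"
      have val: "\<phi> x = g x" if "x \<in> set us" for x
        using PiE_mem[OF \<phi>, of x] that us(2) by auto
      have "\<phi> x \<in> U" if "x \<in> B" for x
        using PiE_mem[OF \<phi> that] gU by (auto split: if_splits)
      then have "\<phi> \<in> B \<rightarrow>\<^sub>E U"
        using \<phi> by (simp add: PiE_iff)
      with val show "\<phi> \<in> {\<phi> \<in> B \<rightarrow>\<^sub>E U. \<forall>x\<in>set us. \<phi> x = g x}"
        by simp
    qed (auto simp: PiE_iff)
    then have "card {\<phi> \<in> B \<rightarrow>\<^sub>E U. map \<phi> us = ys} = (\<Prod>x\<in>B. if x \<in> set us then 1 else card U)"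
      using B by (simp add: card_PiE if_distrib cong: if_cong)
    also have "\<dots> = card U ^ card (B - set us)"
      using B by (subst prod.If_cases) (auto simp: Diff_eq)
    also have "card (B - set us) = card B - length us"
      using us by (simp add: card_Diff_subset distinct_card)
    finally show ?thesis .
  qed
  have "{\<phi> \<in> B \<rightarrow>\<^sub>E U. Q (map \<phi> us)} = (\<Union>ys\<in>R. {\<phi> \<in> B \<rightarrow>\<^sub>E U. map \<phi> us = ys})"
    using us(2) by (auto simp: R_def PiE_iff subset_iff)
  also have "card \<dots> = (\<Sum>ys\<in>R. card {\<phi> \<in> B \<rightarrow>\<^sub>E U. map \<phi> us = ys})"
    using finR fin by (intro card_UN_disjoint) auto
  also have "\<dots> = card R * card U ^ (card B - length us)"
    by (simp add: fibre)
  finally show ?thesis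
    by (simp add: R_def)
qed

lemma sum_of_bool_card: "finite A \<Longrightarrow> (\<Sum>x\<in>A. of_bool (P x)) = real (card {x \<in> A. P x})"
  by (simp add: of_bool_def sum.If_cases Int_def)

lemma length_eq_3_exists: "length xs = 3 \<Longrightarrow> \<exists>a b c. xs = [a, b, c]"
  and length_eq_4_exists: "length xs = 4 \<Longrightarrow> \<exists>a b c d. xs = [a, b, c, d]"
  and length_eq_5_exists: "length xs = 5 \<Longrightarrow> \<exists>a b c d e. xs = [a, b, c, d, e]"
  and length_eq_6_exists: "length xs = 6 \<Longrightarrow> \<exists>a b c d e f. xs = [a, b, c, d, e, f]"
  by (auto simp: length_Suc_conv eval_nat_numeral)

text \<open>The two numerical bounds keep error terms small in \<open>pr_hits_ge\<close>:
  \<open>24 * card B \<le> q ^ 2\<close> those from repeated colours, and \<open>q \<ge> 18\<close>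
  those from triangles sharing two vertices.\<close>

locale random_colouring =
  fixes q :: nat and B :: "'a set"
  assumes prime_q: "prime q" and q_ge: "q \<ge> 18" and finite_B: "finite B" and card_B: "24 * card B \<le> q ^ 2"
begin

definition colourings :: "('a \<Rightarrow> int \<times> int) set" where
  "colourings = B \<rightarrow>\<^sub>E plane q"

definition pr :: "(('a \<Rightarrow> int \<times> int) \<Rightarrow> bool) \<Rightarrow> real" where
  "pr E = real (card {\<phi> \<in> colourings. E \<phi>}) / real (card colourings)"

lemma finite_colourings: "finite colourings"
  using finite_B by (simp add: colourings_def finite_PiE)

lemma card_colourings: "card colourings = q ^ (2 * card B)"
  using finite_B by (simp add: colourings_def card_PiE card_plane power_mult)

lemma q_pos: "q > 0"
  using q_ge by simp

lemma card_colourings_pos: "card colourings > 0"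
  using q_pos by (simp add: card_colourings)

section \<open>Probabilities of one or two triangles\<close>

lemma pr_map:
  assumes "distinct us" "set us \<subseteq> B"
  shows "pr (\<lambda>\<phi>. Q (map \<phi> us)) =
    real (card {ys. set ys \<subseteq> plane q \<and> length ys = length us \<and> Q ys}) / real q ^ (2 * length us)"
proof -
  have "length us \<le> card B"
    using assms finite_B by (metis card_mono distinct_card)
  then have "real q ^ (2 * card B) = real q ^ (2 * length us) * real q ^ (2 * (card B - length us))"
    by (simp flip: power_add add: algebra_simps)
  then show ?thesis
    using card_PiE_map[OF finite_B finite_plane assms, of q Q] q_pos
    unfolding pr_def card_colourings by (simp add: colourings_def card_plane power_mult)
qed

text \<open>The map \<open>g\<close> reads off \<open>l\<close> coordinates that determine all
  \<open>2 * k\<close> of them, so the event has \<open>l\<close> degrees of freedom.\<close>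

lemma pr_le:
  assumes "distinct us" "set us \<subseteq> B" "length us = k"
    and inj: "inj_on g {ys. set ys \<subseteq> plane q \<and> length ys = k \<and> Q ys}"
    and img: "\<And>ys. set ys \<subseteq> plane q \<Longrightarrow> length ys = k \<Longrightarrow> Q ys \<Longrightarrow> set (g ys) \<subseteq> {0..<int q} \<and> length (g ys) = l"
  shows "pr (\<lambda>\<phi>. Q (map \<phi> us)) \<le> real q ^ l / real q ^ (2 * k)"
proof -
  have "card {ys. set ys \<subseteq> plane q \<and> length ys = k \<and> Q ys} \<le> card {zs. set zs \<subseteq> {0..<int q} \<and> length zs = l}"
    using img by (intro card_inj_on_le[OF inj] finite_lists_length_eq) auto
  also have "\<dots> = q ^ l"
    using card_lists_length_eq[of "{0..<int q}" l] by simp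
  finally have "real (card {ys. set ys \<subseteq> plane q \<and> length ys = k \<and> Q ys}) \<le> real (q ^ l)"
    by (simp only: of_nat_le_iff)
  then show ?thesis
    using assms(3) by (simp add: pr_map[OF assms(1,2)] divide_right_mono)
qed

lemma pr_two_triangles_disjoint:
  assumes "distinct [a, b, c, d, e, f]" "set [a, b, c, d, e, f] \<subseteq> B"
  shows "pr (\<lambda>\<phi>. triangle q (\<phi> a) (\<phi> b) (\<phi> c) \<and> triangle q (\<phi> d) (\<phi> e) (\<phi> f)) \<le> 1 / real q ^ 6"
proof -
  let ?Q = "\<lambda>ys. triangle q (ys ! 0) (ys ! 1) (ys ! 2) \<and> triangle q (ys ! 3) (ys ! 4) (ys ! 5)"
  have "pr (\<lambda>\<phi>. ?Q (map \<phi> [a, b, c, d, e, f])) \<le> real q ^ 6 / real q ^ (2 * 6)"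
  proof (rule pr_le[OF assms, where g = "map fst"])
    show "inj_on (map fst) {ys. set ys \<subseteq> plane q \<and> length ys = 6 \<and> ?Q ys}"
    proof (rule inj_onI)
      fix xs ys
      assume xs: "xs \<in> {ys. set ys \<subseteq> plane q \<and> length ys = 6 \<and> ?Q ys}"
        and ys: "ys \<in> {ys. set ys \<subseteq> plane q \<and> length ys = 6 \<and> ?Q ys}"
        and eq: "map fst xs = map fst ys"
      obtain x1 x2 x3 x4 x5 x6 where x: "xs = [x1, x2, x3, x4, x5, x6]"
        using length_eq_6_exists[of xs] xs by blast
      obtain y1 y2 y3 y4 y5 y6 where y: "ys = [y1, y2, y3, y4, y5, y6]"
        using length_eq_6_exists[of ys] ys by blast
      have U: "set xs \<subseteq> plane q" "set ys \<subseteq> plane q"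
        and t: "triangle q x1 x2 x3" "triangle q x4 x5 x6" "triangle q y1 y2 y3" "triangle q y4 y5 y6"
        using xs ys by (auto simp: x y)
      have "x1 = y1 \<and> x2 = y2 \<and> x3 = y3" "x4 = y4 \<and> x5 = y5 \<and> x6 = y6"
        using triangle_determined_by_fst[OF prime_q _ _ _ _ _ _ _ t(1) t(3)]
          triangle_determined_by_fst[OF prime_q _ _ _ _ _ _ _ t(2) t(4)] q_ge U eq by (auto simp: x y)
      then show "xs = ys"
        by (simp add: x y)
    qed
  qed (auto simp: plane_def)
  also have "\<dots> = 1 / real q ^ 6"
    using q_pos by (simp add: power_mult field_simps flip: power_add)
  finally show ?thesis
    by (simp add: numeral_eq_Suc)
qed

text \<open>Four coordinates suffice for five points: three determine the first triangle, the fourth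
  fixes \<open>d\<close> as a neighbour of \<open>a\<close>, and \<open>e\<close> is then the unique
  third vertex. Hence \<open>q ^ 4 / q ^ 10\<close>, no worse than for disjoint triples.\<close>

lemma pr_two_triangles_common_vertex:
  assumes "distinct [a, b, c, d, e]" "set [a, b, c, d, e] \<subseteq> B"
  shows "pr (\<lambda>\<phi>. triangle q (\<phi> a) (\<phi> b) (\<phi> c) \<and> triangle q (\<phi> a) (\<phi> d) (\<phi> e)) \<le> 1 / real q ^ 6"
proof -
  let ?Q = "\<lambda>ys. triangle q (ys ! 0) (ys ! 1) (ys ! 2) \<and> triangle q (ys ! 0) (ys ! 3) (ys ! 4)"
  have "pr (\<lambda>\<phi>. ?Q (map \<phi> [a, b, c, d, e])) \<le> real q ^ 4 / real q ^ (2 * 5)"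
  proof (rule pr_le[OF assms, where g = "\<lambda>ys. map fst (take 4 ys)"])
    show "inj_on (\<lambda>ys. map fst (take 4 ys)) {ys. set ys \<subseteq> plane q \<and> length ys = 5 \<and> ?Q ys}"
    proof (rule inj_onI)
      fix xs ys
      assume xs: "xs \<in> {ys. set ys \<subseteq> plane q \<and> length ys = 5 \<and> ?Q ys}"
        and ys: "ys \<in> {ys. set ys \<subseteq> plane q \<and> length ys = 5 \<and> ?Q ys}"
        and eq: "map fst (take 4 xs) = map fst (take 4 ys)"
      obtain x1 x2 x3 x4 x5 where x: "xs = [x1, x2, x3, x4, x5]"
        using length_eq_5_exists[of xs] xs by blast
      obtain y1 y2 y3 y4 y5 where y: "ys = [y1, y2, y3, y4, y5]"
        using length_eq_5_exists[of ys] ys by blast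
      have U: "set xs \<subseteq> plane q" "set ys \<subseteq> plane q"
        and t: "triangle q x1 x2 x3" "triangle q x1 x4 x5" "triangle q y1 y2 y3" "triangle q y1 y4 y5"
        using xs ys by (auto simp: x y)
      have f: "fst x1 = fst y1" "fst x2 = fst y2" "fst x3 = fst y3" "fst x4 = fst y4"
        using eq by (auto simp: x y)
      have "x1 = y1 \<and> x2 = y2 \<and> x3 = y3"
        using triangle_determined_by_fst[OF prime_q _ _ _ _ _ _ _ t(1) t(3)] q_ge U f by (auto simp: x y)
      moreover from this have "x4 = y4"
        using parab_unique_snd[of q x1 x4 y4] t f U by (auto simp: x y triangle_def)
      ultimately show "xs = ys"
        using triangle_unique_third[OF prime_q, of x1 x4 x5 y5] t U by (auto simp: x y)
    qed
    show "set (map fst (take 4 ys)) \<subseteq> {0..<int q} \<and> length (map fst (take 4 ys)) = 4"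
      if "set ys \<subseteq> plane q" "length ys = 5" for ys
      using that set_take_subset[of 4 ys] by (force simp: plane_def)
  qed simp
  also have "\<dots> = 1 / real q ^ 6"
    using q_pos by (simp add: field_simps flip: power_add)
  finally show ?thesis
    by (simp add: numeral_eq_Suc)
qed

text \<open>Since an edge lies in at most one triangle, \<open>c\<close> and \<open>d\<close> must
  receive the same colour; three coordinates determine four points.\<close>

lemma pr_two_triangles_common_pair:
  assumes "distinct [a, b, c, d]" "set [a, b, c, d] \<subseteq> B"
  shows "pr (\<lambda>\<phi>. triangle q (\<phi> a) (\<phi> b) (\<phi> c) \<and> triangle q (\<phi> a) (\<phi> b) (\<phi> d)) \<le> 1 / real q ^ 5"
proof -
  let ?Q = "\<lambda>ys. triangle q (ys ! 0) (ys ! 1) (ys ! 2) \<and> triangle q (ys ! 0) (ys ! 1) (ys ! 3)"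
  have "pr (\<lambda>\<phi>. ?Q (map \<phi> [a, b, c, d])) \<le> real q ^ 3 / real q ^ (2 * 4)"
  proof (rule pr_le[OF assms, where g = "\<lambda>ys. map fst (take 3 ys)"])
    show "inj_on (\<lambda>ys. map fst (take 3 ys)) {ys. set ys \<subseteq> plane q \<and> length ys = 4 \<and> ?Q ys}"
    proof (rule inj_onI)
      fix xs ys
      assume xs: "xs \<in> {ys. set ys \<subseteq> plane q \<and> length ys = 4 \<and> ?Q ys}"
        and ys: "ys \<in> {ys. set ys \<subseteq> plane q \<and> length ys = 4 \<and> ?Q ys}"
        and eq: "map fst (take 3 xs) = map fst (take 3 ys)"
      obtain x1 x2 x3 x4 where x: "xs = [x1, x2, x3, x4]"
        using length_eq_4_exists[of xs] xs by blast
      obtain y1 y2 y3 y4 where y: "ys = [y1, y2, y3, y4]"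
        using length_eq_4_exists[of ys] ys by blast
      have U: "set xs \<subseteq> plane q" "set ys \<subseteq> plane q"
        and t: "triangle q x1 x2 x3" "triangle q x1 x2 x4" "triangle q y1 y2 y3" "triangle q y1 y2 y4"
        using xs ys by (auto simp: x y)
      have f: "fst x1 = fst y1" "fst x2 = fst y2" "fst x3 = fst y3"
        using eq by (auto simp: x y)
      have "x1 = y1 \<and> x2 = y2 \<and> x3 = y3"
        using triangle_determined_by_fst[OF prime_q _ _ _ _ _ _ _ t(1) t(3)] q_ge U f by (auto simp: x y)
      moreover from this have "x4 = x3" "y4 = y3"
        using triangle_unique_third[OF prime_q, of x1 x2 x3 x4]
          triangle_unique_third[OF prime_q, of y1 y2 y3 y4] t U by (auto simp: x y)
      ultimately show "xs = ys"
        by (simp add: x y)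
    qed
    show "set (map fst (take 3 ys)) \<subseteq> {0..<int q} \<and> length (map fst (take 3 ys)) = 3"
      if "set ys \<subseteq> plane q" "length ys = 4" for ys
      using that set_take_subset[of 3 ys] by (force simp: plane_def)
  qed simp
  also have "\<dots> = 1 / real q ^ 5"
    using q_pos by (simp add: field_simps flip: power_add)
  finally show ?thesis
    by (simp add: numeral_eq_Suc)
qed

lemma pr_triangle_collision:
  assumes "distinct [a, b, c, d]" "set [a, b, c, d] \<subseteq> B" "j < 3"
  shows "pr (\<lambda>\<phi>. triangle q (\<phi> a) (\<phi> b) (\<phi> c) \<and> \<phi> d = [\<phi> a, \<phi> b, \<phi> c] ! j) \<le> 1 / real q ^ 5"
proof -
  let ?Q = "\<lambda>ys. triangle q (ys ! 0) (ys ! 1) (ys ! 2) \<and> ys ! 3 = ys ! j"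
  have "pr (\<lambda>\<phi>. ?Q (map \<phi> [a, b, c, d])) \<le> real q ^ 3 / real q ^ (2 * 4)"
  proof (rule pr_le[OF assms(1,2), where g = "\<lambda>ys. map fst (take 3 ys)"])
    show "inj_on (\<lambda>ys. map fst (take 3 ys)) {ys. set ys \<subseteq> plane q \<and> length ys = 4 \<and> ?Q ys}"
    proof (rule inj_onI)
      fix xs ys
      assume xs: "xs \<in> {ys. set ys \<subseteq> plane q \<and> length ys = 4 \<and> ?Q ys}"
        and ys: "ys \<in> {ys. set ys \<subseteq> plane q \<and> length ys = 4 \<and> ?Q ys}"
        and eq: "map fst (take 3 xs) = map fst (take 3 ys)"
      obtain x1 x2 x3 x4 where x: "xs = [x1, x2, x3, x4]"
        using length_eq_4_exists[of xs] xs by blast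
      obtain y1 y2 y3 y4 where y: "ys = [y1, y2, y3, y4]"
        using length_eq_4_exists[of ys] ys by blast
      have U: "set xs \<subseteq> plane q" "set ys \<subseteq> plane q"
        and t: "triangle q x1 x2 x3" "triangle q y1 y2 y3" and 4: "x4 = xs ! j" "y4 = ys ! j"
        using xs ys by (auto simp: x y)
      have f: "fst x1 = fst y1" "fst x2 = fst y2" "fst x3 = fst y3"
        using eq by (auto simp: x y)
      have "x1 = y1 \<and> x2 = y2 \<and> x3 = y3"
        using triangle_determined_by_fst[OF prime_q _ _ _ _ _ _ _ t] q_ge U f by (auto simp: x y)
      with 4 assms(3) show "xs = ys"
        by (auto simp: x y less_Suc_eq numeral_eq_Suc)
    qed
    show "set (map fst (take 3 ys)) \<subseteq> {0..<int q} \<and> length (map fst (take 3 ys)) = 3"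
      if "set ys \<subseteq> plane q" "length ys = 4" for ys
      using that set_take_subset[of 3 ys] by (force simp: plane_def)
  qed simp
  also have "\<dots> = 1 / real q ^ 5"
    using q_pos by (simp add: field_simps flip: power_add)
  finally show ?thesis
    using assms(3) by (auto simp: less_Suc_eq numeral_eq_Suc)
qed

lemma pr_triangle_ge:
  assumes "distinct [a, b, c]" "set [a, b, c] \<subseteq> B"
  shows "pr (\<lambda>\<phi>. triangle q (\<phi> a) (\<phi> b) (\<phi> c)) \<ge> 1 / (2 * real q ^ 3)"
proof -
  let ?Q = "\<lambda>ys. triangle q (ys ! 0) (ys ! 1) (ys ! 2)"
  let ?R = "{ys. set ys \<subseteq> plane q \<and> length ys = 3 \<and> ?Q ys}"
  have fin: "finite ?R"
    by (rule finite_subset[OF _ finite_lists_length_eq[OF finite_plane, of q 3]]) auto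
  have "{xs. length xs = 3 \<and> distinct xs \<and> set xs \<subseteq> {0..<int q}} \<subseteq> map fst ` ?R"
  proof
    fix xs assume xs: "xs \<in> {xs. length xs = 3 \<and> distinct xs \<and> set xs \<subseteq> {0..<int q}}"
    then obtain x y z where x: "xs = [x, y, z]"
      using length_eq_3_exists[of xs] by blast
    obtain u v w where "u \<in> plane q" "v \<in> plane q" "w \<in> plane q" "triangle q u v w"
      "fst u = x" "fst v = y" "fst w = z"
      using exists_triangle[of q x y z] prime_q q_ge xs by (auto simp: x)
    then show "xs \<in> map fst ` ?R"
      by (intro image_eqI[of _ _ "[u, v, w]"]) (auto simp: x)
  qed
  then have "card {xs. length xs = 3 \<and> distinct xs \<and> set xs \<subseteq> {0..<int q}} \<le> card ?R"
    by (rule surj_card_le[OF fin])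
  moreover have "card {xs. length xs = 3 \<and> distinct xs \<and> set xs \<subseteq> {0..<int q}} = \<Prod>{q - 3 + 1..q}"
    using card_lists_distinct_length_eq[of "{0..<int q}" 3] q_ge by simp
  moreover have "{q - 3 + 1..q} = {q - 2, q - 1, q}"
    using q_ge by auto
  moreover have "\<Prod>{q - 2, q - 1, q} = (q - 2) * ((q - 1) * q)"
  proof -
    have "q - 2 \<noteq> q - 1" "q - 2 \<noteq> q" "q - 1 \<noteq> q"
      using q_ge by linarith+
    then show ?thesis
      by simp
  qed
  ultimately have "(q - 2) * ((q - 1) * q) \<le> card ?R"
    by simp
  then have "real ((q - 2) * ((q - 1) * q)) \<le> real (card ?R)"
    by (simp only: of_nat_le_iff)
  moreover have "real ((q - 2) * ((q - 1) * q)) = (real q - 2) * ((real q - 1) * real q)"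
    using q_ge by (simp add: of_nat_diff)
  moreover have "real q * real q * real q \<le> 2 * ((real q - 2) * ((real q - 1) * real q))"
  proof -
    have "6 * real q \<le> real q * real q"
      using q_ge by (intro mult_right_mono) auto
    then have "real q * real q \<le> 2 * ((real q - 2) * (real q - 1))"
      by (simp add: algebra_simps)
    then have "real q * real q * real q \<le> 2 * ((real q - 2) * (real q - 1)) * real q"
      by (rule mult_right_mono) simp
    then show ?thesis
      by (simp add: mult.assoc)
  qed
  ultimately have "real q ^ 3 \<le> 2 * real (card ?R)"
    unfolding power3_eq_cube by linarith
  then have "(real q ^ 3 / 2) / (real q ^ 3 * real q ^ 3) \<le> real (card ?R) / (real q ^ 3 * real q ^ 3)"
    by (intro divide_right_mono) auto
  moreover have "(real q ^ 3 / 2) / (real q ^ 3 * real q ^ 3) = 1 / (2 * real q ^ 3)"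
    using q_pos by (simp add: field_simps)
  moreover have "real q ^ 3 * real q ^ 3 = real q ^ (2 * 3)"
    by (simp flip: power_add)
  ultimately have "1 / (2 * real q ^ 3) \<le> real (card ?R) / real q ^ (2 * 3)"
    by (simp only:)
  also have "\<dots> = pr (\<lambda>\<phi>. ?Q (map \<phi> [a, b, c]))"
    using pr_map[OF assms, where Q = ?Q] by (simp add: numeral_eq_Suc)
  finally show ?thesis
    by (simp add: numeral_eq_Suc)
qed

end

text \<open>
  Requiring the three colours to be unique in \<open>B\<close> makes up for the colouring not being injective, and
  leaves the colours of distinct vertices independent.
\<close>

definition clean_triangle :: "nat \<Rightarrow> 'a set \<Rightarrow> ('a \<Rightarrow> int \<times> int) \<Rightarrow> 'a \<Rightarrow> 'a \<Rightarrow> 'a \<Rightarrow> bool" where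
  "clean_triangle q B \<phi> u v w \<longleftrightarrow> triangle q (\<phi> u) (\<phi> v) (\<phi> w) \<and>
     (\<forall>x\<in>B. \<forall>y\<in>{u, v, w}. \<phi> x = \<phi> y \<longrightarrow> x = y)"

definition hits :: "nat \<Rightarrow> 'a set \<Rightarrow> 'a set \<Rightarrow> ('a \<Rightarrow> int \<times> int) \<Rightarrow> bool" where
  "hits q B A \<phi> \<longleftrightarrow> (\<exists>u\<in>A. \<exists>v\<in>A. \<exists>w\<in>A. clean_triangle q B \<phi> u v w)"

text \<open>For integers \<open>(n - 1) * (n - 2)\<close> is nonnegative. This is Bonferroni's bound
  \<open>n - n * (n - 1) / 2 \<le> 1\<close>, doubled.\<close>

lemma three_n_minus_square_le_two: "3 * real n - real n ^ 2 \<le> 2"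
proof -
  have "n \<le> 1 \<or> n \<ge> 2"
    by linarith
  then have "0 \<le> (real n - 1) * (real n - 2)"
    by (auto simp: mult_nonpos_nonpos)
  then show ?thesis
    by (simp add: algebra_simps power2_eq_square)
qed

context random_colouring
begin

lemma sum_colourings_of_bool:
  assumes "finite K"
  shows "(\<Sum>\<phi>\<in>colourings. \<Sum>k\<in>K. of_bool (P k \<phi>)) = real (card colourings) * (\<Sum>k\<in>K. pr (P k))"
proof -
  have "(\<Sum>\<phi>\<in>colourings. \<Sum>k\<in>K. of_bool (P k \<phi>)) = (\<Sum>k\<in>K. real (card {\<phi> \<in> colourings. P k \<phi>}))"
    by (subst sum.swap) (simp only: sum_of_bool_card[OF finite_colourings])
  also have "\<dots> = (\<Sum>k\<in>K. real (card colourings) * pr (P k))"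
    using card_colourings_pos by (simp add: pr_def)
  finally show ?thesis
    by (simp add: sum_distrib_left)
qed

text \<open>Only triples with one vertex in each of three disjoint \<open>r\<close>-subsets of
  \<open>A\<close> are counted, so every triple has a fixed order. The cap
  \<open>2 * r \<le> q\<close> keeps the expected number of triangles bounded, so that the second
  moment does not swamp the first.\<close>

lemma pr_hits_ge:
  assumes A: "A \<subseteq> B" "3 * r \<le> card A" and r: "2 * r \<le> q"
  shows "real r ^ 3 / (4 * real q ^ 3) \<le> pr (hits q B A)"
proof -
  have finA: "finite A"
    using A finite_B by (auto intro: finite_subset)
  obtain A1 where A1: "A1 \<subseteq> A" "card A1 = r"
    using obtain_subset_with_card_n[of r A] A by auto
  then have "card (A - A1) \<ge> 2 * r"
    using A finA by (simp add: card_Diff_subset finite_subset)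
  then obtain A2 where A2: "A2 \<subseteq> A - A1" "card A2 = r"
    using obtain_subset_with_card_n[of r "A - A1"] by auto
  then have "card (A - A1 - A2) \<ge> r"
    using \<open>card (A - A1) \<ge> 2 * r\<close> finA by (simp add: card_Diff_subset finite_subset)
  then obtain A3 where A3: "A3 \<subseteq> A - A1 - A2" "card A3 = r"
    using obtain_subset_with_card_n[of r "A - A1 - A2"] by auto
  have fin: "finite A1" "finite A2" "finite A3"
    using A1 A2 A3 finA by (meson Diff_subset finite_subset order.trans)+
  have dist: "distinct [a, b, c]" "{a, b, c} \<subseteq> B" if "a \<in> A1" "b \<in> A2" "c \<in> A3" for a b c
    using that A1 A2 A3 A by auto
  have dist6: "a \<noteq> b" "a \<noteq> c" "b \<noteq> c" "a \<in> B" "b \<in> B" "c \<in> B" if "a \<in> A1" "b \<in> A2" "c \<in> A3" for a b c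
    using that A1 A2 A3 A by auto
  define T where "T = A1 \<times> A2 \<times> A3"
  define tri where "tri = (\<lambda>(a :: 'a, b, c) \<phi>. triangle q (\<phi> a) (\<phi> b) (\<phi> c))"
  \<comment> \<open>An element records a triple, a vertex \<open>x\<close> outside it and the
    position \<open>j\<close> of the colour that \<open>x\<close> might repeat.\<close>
  define K where "K = (SIGMA t:T. (B - {fst t, fst (snd t), snd (snd t)}) \<times> {..<3::nat})"
  define col where "col = (\<lambda>((a :: 'a, b, c), x, j) \<phi>. triangle q (\<phi> a) (\<phi> b) (\<phi> c) \<and> \<phi> x = [\<phi> a, \<phi> b, \<phi> c] ! j)"
  have finT: "finite T" and finK: "finite K"
    using fin finite_B by (auto simp: T_def K_def)
  have cardT: "real (card T) = real r ^ 3"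
    using A1 A2 A3 by (simp add: T_def card_cartesian_product power3_eq_cube)
  define X where "X \<phi> = (\<Sum>t\<in>T. of_bool (tri t \<phi>) :: real)" for \<phi>
  define Y where "Y \<phi> = (\<Sum>k\<in>K. of_bool (col k \<phi>) :: real)" for \<phi>
  \<comment> \<open>Bonferroni's inequality, with \<open>Y\<close> correcting for the triangles that are not clean.\<close>
  have pointwise: "3 * X \<phi> - (X \<phi>)\<^sup>2 - 2 * Y \<phi> \<le> 2 * of_bool (hits q B A \<phi>)" for \<phi>
  proof -
    have X: "X \<phi> = real (card {t \<in> T. tri t \<phi>})"
      unfolding X_def by (rule sum_of_bool_card[OF finT])
    have Y: "Y \<phi> = real (card {k \<in> K. col k \<phi>})"
      unfolding Y_def by (rule sum_of_bool_card[OF finK])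
    show ?thesis
    proof (cases "hits q B A \<phi>")
      case True
      then show ?thesis
        using three_n_minus_square_le_two[of "card {t \<in> T. tri t \<phi>}"] X Y by simp
    next
      case False
      have "{t \<in> T. tri t \<phi>} \<subseteq> fst ` {k \<in> K. col k \<phi>}"
      proof
        fix t assume t: "t \<in> {t \<in> T. tri t \<phi>}"
        obtain a b c where abc: "t = (a, b, c)"
          by (cases t)
        have tri: "triangle q (\<phi> a) (\<phi> b) (\<phi> c)" and mem: "a \<in> A1" "b \<in> A2" "c \<in> A3"
          using t by (auto simp: tri_def abc T_def)
        have "a \<in> A" "b \<in> A" "c \<in> A"
          using mem A1 A2 A3 by auto
        then have "\<not> clean_triangle q B \<phi> a b c"
          using False by (auto simp: hits_def)
        then obtain x y where xy: "x \<in> B" "y \<in> {a, b, c}" "\<phi> x = \<phi> y" "x \<noteq> y"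
          using tri by (auto simp: clean_triangle_def)
        have "\<phi> a \<noteq> \<phi> b" "\<phi> b \<noteq> \<phi> c" "\<phi> a \<noteq> \<phi> c"
          using tri by (auto simp: triangle_def)
        then have "x \<notin> {a, b, c}"
          using xy by auto
        moreover obtain j where "j < 3" "\<phi> y = [\<phi> a, \<phi> b, \<phi> c] ! j"
        proof -
          have "\<phi> y = [\<phi> a, \<phi> b, \<phi> c] ! 0 \<or> \<phi> y = [\<phi> a, \<phi> b, \<phi> c] ! 1 \<or> \<phi> y = [\<phi> a, \<phi> b, \<phi> c] ! 2"
            using xy by auto
          then show thesis
            using that[of 0] that[of 1] that[of 2] by auto
        qed
        ultimately have "((a, b, c), x, j) \<in> {k \<in> K. col k \<phi>}"
          using t tri xy by (auto simp: K_def col_def abc)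
        then show "t \<in> fst ` {k \<in> K. col k \<phi>}"
          unfolding abc by (rule rev_image_eqI) simp
      qed
      \<comment> \<open>Without a clean triangle each triangle has a colour repeated outside it.
        Together with \<open>X \<le> X ^ 2\<close> for a count \<open>X\<close>, this makes the
        left-hand side of \<open>pointwise\<close> at most \<open>2 * X - 2 * Y\<close>, hence at
        most 0.\<close>
      then have "X \<phi> \<le> Y \<phi>"
        unfolding X Y using finK by (simp add: surj_card_le)
      moreover have "X \<phi> \<le> (X \<phi>)\<^sup>2"
        unfolding X using le_square[of "card {t \<in> T. tri t \<phi>}"]
        by (simp add: power2_eq_square flip: of_nat_mult)
      ultimately show ?thesis
        using False by simp
    qed
  qed
  have sq: "(X \<phi>)\<^sup>2 = (\<Sum>p\<in>T \<times> T. of_bool (tri (fst p) \<phi> \<and> tri (snd p) \<phi>))" for \<phi>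
    unfolding X_def power2_eq_square sum_product sum.cartesian_product
    by (intro sum.cong) (auto simp: of_bool_conj)
  let ?\<Omega> = "real (card colourings)"
  have "(\<Sum>\<phi>\<in>colourings. 3 * X \<phi> - (X \<phi>)\<^sup>2 - 2 * Y \<phi>) \<le> (\<Sum>\<phi>\<in>colourings. 2 * of_bool (hits q B A \<phi>))"
    by (intro sum_mono pointwise)
  moreover have "(\<Sum>\<phi>\<in>colourings. 3 * X \<phi> - (X \<phi>)\<^sup>2 - 2 * Y \<phi>) =
      3 * (\<Sum>\<phi>\<in>colourings. X \<phi>) - (\<Sum>\<phi>\<in>colourings. (X \<phi>)\<^sup>2) - 2 * (\<Sum>\<phi>\<in>colourings. Y \<phi>)"
    by (simp add: sum_subtractf sum_distrib_left)
  moreover have "(\<Sum>\<phi>\<in>colourings. X \<phi>) = ?\<Omega> * (\<Sum>t\<in>T. pr (tri t))"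
    unfolding X_def by (rule sum_colourings_of_bool[OF finT])
  moreover have "(\<Sum>\<phi>\<in>colourings. (X \<phi>)\<^sup>2) = ?\<Omega> * (\<Sum>p\<in>T \<times> T. pr (\<lambda>\<phi>. tri (fst p) \<phi> \<and> tri (snd p) \<phi>))"
    unfolding sq using finT by (intro sum_colourings_of_bool) auto
  moreover have "(\<Sum>\<phi>\<in>colourings. Y \<phi>) = ?\<Omega> * (\<Sum>k\<in>K. pr (col k))"
    unfolding Y_def by (rule sum_colourings_of_bool[OF finK])
  moreover have "(\<Sum>\<phi>\<in>colourings. 2 * of_bool (hits q B A \<phi>)) = 2 * (?\<Omega> * pr (hits q B A))"
    using finite_colourings card_colourings_pos
    by (simp add: pr_def Int_def flip: sum_distrib_left)
  ultimately have "?\<Omega> * (3 * (\<Sum>t\<in>T. pr (tri t)) -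
      (\<Sum>p\<in>T \<times> T. pr (\<lambda>\<phi>. tri (fst p) \<phi> \<and> tri (snd p) \<phi>)) - 2 * (\<Sum>k\<in>K. pr (col k))) \<le>
      ?\<Omega> * (2 * pr (hits q B A))"
    by (simp add: algebra_simps)
  then have main: "3 * (\<Sum>t\<in>T. pr (tri t)) -
      (\<Sum>p\<in>T \<times> T. pr (\<lambda>\<phi>. tri (fst p) \<phi> \<and> tri (snd p) \<phi>)) - 2 * (\<Sum>k\<in>K. pr (col k)) \<le> 2 * pr (hits q B A)"
    using card_colourings_pos by simp
  have lower: "(\<Sum>t\<in>T. pr (tri t)) \<ge> real r ^ 3 * (1 / (2 * real q ^ 3))"
  proof -
    have "(\<Sum>t\<in>T. 1 / (2 * real q ^ 3)) \<le> (\<Sum>t\<in>T. pr (tri t))"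
    proof (rule sum_mono)
      fix t assume "t \<in> T"
      then show "1 / (2 * real q ^ 3) \<le> pr (tri t)"
        using pr_triangle_ge dist by (auto simp: T_def tri_def)
    qed
    then show ?thesis
      by (simp add: cardT)
  qed
  have col: "(\<Sum>k\<in>K. pr (col k)) \<le> real r ^ 3 * (3 * real (card B)) * (1 / real q ^ 5)"
  proof -
    have "card K = (\<Sum>t\<in>T. card (B - {fst t, fst (snd t), snd (snd t)}) * 3)"
      using finT finite_B by (simp add: K_def card_cartesian_product)
    also have "\<dots> \<le> (\<Sum>t\<in>T. card B * 3)"
      using finite_B by (intro sum_mono mult_right_mono card_mono) auto
    finally have "real (card K) \<le> real (card T * (card B * 3))"
      by (simp del: of_nat_mult)
    then have cardK: "real (card K) \<le> real r ^ 3 * (3 * real (card B))"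
      by (simp add: cardT mult.commute)
    have "(\<Sum>k\<in>K. pr (col k)) \<le> (\<Sum>k\<in>K. 1 / real q ^ 5)"
    proof (rule sum_mono)
      fix k assume k: "k \<in> K"
      obtain a b c x j where abc: "k = ((a, b, c), x, j)"
        by (cases k) auto
      have "a \<in> A1" "b \<in> A2" "c \<in> A3" "x \<in> B" "x \<notin> {a, b, c}" "j < 3"
        using k by (auto simp: abc K_def T_def)
      then show "pr (col k) \<le> 1 / real q ^ 5"
        using pr_triangle_collision[of a b c x j] dist[of a b c] by (auto simp: abc col_def)
    qed
    also have "\<dots> = real (card K) * (1 / real q ^ 5)"
      by simp
    also have "\<dots> \<le> real r ^ 3 * (3 * real (card B)) * (1 / real q ^ 5)"
      using cardK by (intro mult_right_mono) auto
    finally show ?thesis .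
  qed
  \<comment> \<open>Triples sharing one vertex are as unlikely as disjoint ones; only the few triples in \<open>Z t\<close>, which
    share two vertices with \<open>t\<close>, cost an extra factor \<open>q\<close>.\<close>
  define Z where "Z = (\<lambda>(a, b, c). {a} \<times> {b} \<times> A3 \<union> {a} \<times> A2 \<times> {c} \<union> A1 \<times> {b} \<times> {c})"
  have cardZ: "card (Z t) \<le> 3 * r" "finite (Z t)" for t
  proof -
    obtain a b c where t: "t = (a, b, c)"
      by (cases t)
    have "card (Z t) \<le> card ({a} \<times> {b} \<times> A3) + card ({a} \<times> A2 \<times> {c}) + card (A1 \<times> {b} \<times> {c})"
      unfolding Z_def t prod.case by (meson add_right_mono card_Un_le order.trans)
    then show "card (Z t) \<le> 3 * r"
      using A1 A2 A3 by (simp add: card_cartesian_product)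
    show "finite (Z t)"
      using fin by (simp add: Z_def t)
  qed
  have pair: "pr (\<lambda>\<phi>. tri t \<phi> \<and> tri t' \<phi>) \<le>
      of_bool (t = t') * pr (tri t) + 1 / real q ^ 6 + of_bool (t' \<in> Z t) * (1 / real q ^ 5)"
    if t: "t \<in> T" "t' \<in> T" for t t'
  proof -
    obtain a b c where abc: "t = (a, b, c)"
      by (cases t)
    obtain a' b' c' where abc': "t' = (a', b', c')"
      by (cases t')
    have m: "a \<in> A1" "b \<in> A2" "c \<in> A3" "a' \<in> A1" "b' \<in> A2" "c' \<in> A3"
      using t by (auto simp: abc abc' T_def)
    note d = dist6[OF m(1-3)] dist6[OF m(1,2,6)] dist6[OF m(1,5,3)] dist6[OF m(1,5,6)]
      dist6[OF m(4,2,3)] dist6[OF m(4,2,6)] dist6[OF m(4,5,3)] dist6[OF m(4,5,6)]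
    have nonneg: "0 \<le> 1 / real q ^ 6" "0 \<le> 1 / real q ^ 5"
      by simp_all
    let ?p = "pr (\<lambda>\<phi>. triangle q (\<phi> a) (\<phi> b) (\<phi> c) \<and> triangle q (\<phi> a') (\<phi> b') (\<phi> c'))"
    consider "t = t'" | "t \<noteq> t'" "t' \<in> Z t" | "t' \<notin> Z t"
      by auto
    then show ?thesis
    proof cases
      case 1
      then show ?thesis
        by simp
    next
      case 2
      then consider "a = a'" "b = b'" "c \<noteq> c'" | "a = a'" "c = c'" "b \<noteq> b'" | "b = b'" "c = c'" "a \<noteq> a'"
        by (auto simp: Z_def abc abc')
      then have "?p \<le> 1 / real q ^ 5"
      proof cases
        case 1
        then show ?thesis
          using pr_two_triangles_common_pair[of a b c c'] d by auto
      next
        case 2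
        then have "?p = pr (\<lambda>\<phi>. triangle q (\<phi> c) (\<phi> a) (\<phi> b) \<and> triangle q (\<phi> c) (\<phi> a) (\<phi> b'))"
          by (intro arg_cong[of _ _ pr] ext) (metis triangle_rotate)
        then show ?thesis
          using pr_two_triangles_common_pair[of c a b b'] d 2 by auto
      next
        case 3
        then have "?p = pr (\<lambda>\<phi>. triangle q (\<phi> b) (\<phi> c) (\<phi> a) \<and> triangle q (\<phi> b) (\<phi> c) (\<phi> a'))"
          by (intro arg_cong[of _ _ pr] ext) (metis triangle_rotate)
        then show ?thesis
          using pr_two_triangles_common_pair[of b c a a'] d 3 by auto
      qed
      then have "0 + ?p \<le> 1 / real q ^ 6 + 1 / real q ^ 5"
        by (rule add_mono[OF nonneg(1)])
      then show ?thesis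
        using 2 by (simp add: tri_def abc abc')
    next
      case 3
      then have ne: "t \<noteq> t'"
        using m by (auto simp: Z_def abc abc')
      from 3 consider "a = a'" "b \<noteq> b'" "c \<noteq> c'" | "b = b'" "a \<noteq> a'" "c \<noteq> c'"
        | "c = c'" "a \<noteq> a'" "b \<noteq> b'" | "a \<noteq> a'" "b \<noteq> b'" "c \<noteq> c'"
        using m by (auto simp: Z_def abc abc')
      then have "?p \<le> 1 / real q ^ 6"
      proof cases
        case 1
        then show ?thesis
          using pr_two_triangles_common_vertex[of a b c b' c'] d by auto
      next
        case 2
        then have "?p = pr (\<lambda>\<phi>. triangle q (\<phi> b) (\<phi> c) (\<phi> a) \<and> triangle q (\<phi> b) (\<phi> c') (\<phi> a'))"
          by (intro arg_cong[of _ _ pr] ext) (metis triangle_rotate)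
        then show ?thesis
          using pr_two_triangles_common_vertex[of b c a c' a'] d 2 by auto
      next
        case 3
        then have "?p = pr (\<lambda>\<phi>. triangle q (\<phi> c) (\<phi> a) (\<phi> b) \<and> triangle q (\<phi> c) (\<phi> a') (\<phi> b'))"
          by (intro arg_cong[of _ _ pr] ext) (metis triangle_rotate)
        then show ?thesis
          using pr_two_triangles_common_vertex[of c a b a' b'] d 3 by auto
      next
        case 4
        then show ?thesis
          using pr_two_triangles_disjoint[of a b c a' b' c'] d by auto
      qed
      then show ?thesis
        using 3 ne by (simp add: tri_def abc abc')
    qed
  qed
  have pairs: "(\<Sum>p\<in>T \<times> T. pr (\<lambda>\<phi>. tri (fst p) \<phi> \<and> tri (snd p) \<phi>)) \<le>
      (\<Sum>t\<in>T. pr (tri t)) + real r ^ 6 * (1 / real q ^ 6) + real r ^ 3 * (3 * real r) * (1 / real q ^ 5)"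
  proof -
    have "(\<Sum>p\<in>T \<times> T. pr (\<lambda>\<phi>. tri (fst p) \<phi> \<and> tri (snd p) \<phi>)) =
        (\<Sum>t\<in>T. \<Sum>t'\<in>T. pr (\<lambda>\<phi>. tri t \<phi> \<and> tri t' \<phi>))"
      by (simp add: sum.cartesian_product case_prod_beta)
    also have "\<dots> \<le> (\<Sum>t\<in>T. pr (tri t) + real r ^ 3 * (1 / real q ^ 6) + (3 * real r) * (1 / real q ^ 5))"
    proof (rule sum_mono)
      fix t assume t: "t \<in> T"
      have "(\<Sum>t'\<in>T. pr (\<lambda>\<phi>. tri t \<phi> \<and> tri t' \<phi>)) \<le>
          (\<Sum>t'\<in>T. of_bool (t = t') * pr (tri t) + 1 / real q ^ 6 + of_bool (t' \<in> Z t) * (1 / real q ^ 5))"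
        by (intro sum_mono pair t)
      also have "\<dots> = (\<Sum>t'\<in>T. of_bool (t = t')) * pr (tri t) + real r ^ 3 * (1 / real q ^ 6)
          + (\<Sum>t'\<in>T. of_bool (t' \<in> Z t)) * (1 / real q ^ 5)"
        by (simp only: sum.distrib sum_distrib_right[symmetric] sum_constant cardT)
      also have "(\<Sum>t'\<in>T. of_bool (t = t')) = (1 :: real)"
        using t finT by (simp add: of_bool_def)
      also have "(\<Sum>t'\<in>T. of_bool (t' \<in> Z t)) * (1 / real q ^ 5) \<le> (3 * real r) * (1 / real q ^ 5)"
      proof (rule mult_right_mono)
        have "card {t' \<in> T. t' \<in> Z t} \<le> card (Z t)"
          using cardZ by (intro card_mono) auto
        then have "real (card {t' \<in> T. t' \<in> Z t}) \<le> real (3 * r)"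
          using cardZ(1)[of t] by linarith
        then show "(\<Sum>t'\<in>T. of_bool (t' \<in> Z t)) \<le> 3 * real r"
          by (simp add: sum_of_bool_card[OF finT])
      qed simp
      finally show "(\<Sum>t'\<in>T. pr (\<lambda>\<phi>. tri t \<phi> \<and> tri t' \<phi>)) \<le>
          pr (tri t) + real r ^ 3 * (1 / real q ^ 6) + (3 * real r) * (1 / real q ^ 5)"
        by simp
    qed
    also have "\<dots> = (\<Sum>t\<in>T. pr (tri t)) + real r ^ 3 * (real r ^ 3 * (1 / real q ^ 6)) +
        real r ^ 3 * ((3 * real r) * (1 / real q ^ 5))"
      by (simp only: sum.distrib sum_constant cardT)
    finally show ?thesis
      by (simp add: mult.assoc flip: power_add)
  qed
  \<comment> \<open>Twice the expected number of triangles is at least \<open>\<rho>\<close>. The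
    losses are \<open>\<rho> / 8\<close>, \<open>\<rho> / 12\<close> and \<open>\<rho> / 4\<close>,
    so more than \<open>\<rho> / 2\<close> remains for twice the probability.\<close>
  define \<rho> where "\<rho> = real r ^ 3 / real q ^ 3"
  have "\<rho> = (real r / real q) ^ 3"
    by (simp add: \<rho>_def power_divide)
  also have "\<dots> \<le> (1 / 2) ^ 3"
    using r q_pos by (intro power_mono) (auto simp: field_simps)
  finally have \<rho>: "\<rho> \<le> 1 / 8" "\<rho> \<ge> 0"
    by (auto simp: \<rho>_def power3_eq_cube)
  have e1: "real r ^ 6 * (1 / real q ^ 6) = \<rho> * \<rho>"
    by (simp add: \<rho>_def flip: power_add)
  have e2: "real r ^ 3 * x * (1 / real q ^ 5) = \<rho> * (x / real q ^ 2)" for x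
    using q_pos by (simp add: \<rho>_def flip: power_add)
  have b1: "3 * real r / real q ^ 2 \<le> 1 / 12"
  proof -
    have "36 * real r \<le> 18 * real q"
      using r by simp
    also have "\<dots> \<le> real q * real q"
      using q_ge by (intro mult_right_mono) auto
    finally show ?thesis
      using q_pos by (simp add: field_simps power2_eq_square)
  qed
  have b2: "3 * real (card B) / real q ^ 2 \<le> 1 / 8"
  proof -
    have "real (24 * card B) \<le> real (q ^ 2)"
      using card_B by (simp only: of_nat_le_iff)
    then show ?thesis
      using q_pos by (simp add: field_simps)
  qed
  have "real r ^ 3 * (1 / (2 * real q ^ 3)) = \<rho> / 2"
    by (simp add: \<rho>_def)
  then have "\<rho> - \<rho> * \<rho> - \<rho> * (3 * real r / real q ^ 2) - 2 * (\<rho> * (3 * real (card B) / real q ^ 2))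
      \<le> 2 * pr (hits q B A)"
    using main lower col pairs unfolding e1 e2 by linarith
  moreover have "\<rho> * \<rho> \<le> \<rho> * (1 / 8)" "\<rho> * (3 * real r / real q ^ 2) \<le> \<rho> * (1 / 12)"
    "\<rho> * (3 * real (card B) / real q ^ 2) \<le> \<rho> * (1 / 8)"
    using \<rho> b1 b2 by (auto intro!: mult_left_mono simp del: times_divide_eq_right)
  ultimately have "\<rho> / 4 \<le> pr (hits q B A)"
    using \<rho>(2) by linarith
  then show ?thesis
    by (simp add: \<rho>_def mult.commute)
qed

end

section \<open>The random block hypergraph\<close>

definition block_hgraph :: "nat \<Rightarrow> 'a set \<Rightarrow> 'i set \<Rightarrow> ('i \<Rightarrow> 'a set) \<Rightarrow> ('i \<Rightarrow> 'a \<Rightarrow> int \<times> int) \<Rightarrow> 'a hgraph" where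
  "block_hgraph q V I B \<omega> =
     (V, {{u, v, w} | u v w. \<exists>i\<in>I. {u, v, w} \<subseteq> B i \<and> clean_triangle q (B i) (\<omega> i) u v w})"

lemma block_hgraph_edgeE:
  assumes "e \<in> edges (block_hgraph q V I B \<omega>)"
  obtains u v w i where "e = {u, v, w}" "i \<in> I" "{u, v, w} \<subseteq> B i" "clean_triangle q (B i) (\<omega> i) u v w"
  using assms by (auto simp: block_hgraph_def)

lemma uniform_block_hgraph:
  assumes "finite V" "\<And>i. i \<in> I \<Longrightarrow> B i \<subseteq> V"
  shows "uniform_hgraph 3 (block_hgraph q V I B \<omega>)"
  unfolding uniform_hgraph_def
proof (intro conjI ballI)
  fix e assume "e \<in> edges (block_hgraph q V I B \<omega>)"
  then obtain u v w i where e: "e = {u, v, w}" "i \<in> I" "{u, v, w} \<subseteq> B i"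
    and "clean_triangle q (B i) (\<omega> i) u v w"
    by (rule block_hgraph_edgeE)
  then have "u \<noteq> v" "v \<noteq> w" "u \<noteq> w"
    by (auto simp: clean_triangle_def triangle_def)
  then show "card e = 3"
    by (simp add: e)
  show "e \<subseteq> verts (block_hgraph q V I B \<omega>)"
    using e assms(2) by (auto simp: block_hgraph_def)
qed (use assms in \<open>simp add: block_hgraph_def\<close>)

lemma clean_triangle_parab:
  assumes "clean_triangle q B \<phi> u v w" "x \<in> {u, v, w}" "y \<in> {u, v, w}" "x \<noteq> y"
  shows "parab q (\<phi> x) (\<phi> y)"
proof -
  have tri: "parab q (\<phi> u) (\<phi> v)" "parab q (\<phi> v) (\<phi> w)" "parab q (\<phi> u) (\<phi> w)"
    using assms(1) by (auto simp: clean_triangle_def triangle_def)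
  then have "parab q (\<phi> v) (\<phi> u)" "parab q (\<phi> w) (\<phi> v)" "parab q (\<phi> w) (\<phi> u)"
    by (simp_all add: parab_sym[of q "\<phi> v" "\<phi> u"] parab_sym[of q "\<phi> w" "\<phi> v"] parab_sym[of q "\<phi> w" "\<phi> u"])
  with tri show ?thesis
    using assms(2-4) by auto
qed

text \<open>All four edges come from one block. There the colours of \<open>x0\<close> and
  \<open>x2\<close> have those of \<open>x1\<close> and \<open>x3\<close> as common neighbours, so
  one of these pairs has equal colours; cleanness of \<open>e0\<close> or \<open>e1\<close> then
  makes its vertices equal.\<close>

lemma block_hgraph_no_closed_chain:
  assumes q: "prime q" and col: "\<And>i. i \<in> I \<Longrightarrow> \<omega> i \<in> B i \<rightarrow>\<^sub>E plane q"
    and blocks: "\<And>i0 i1 i2 i3 v0 v1 v2 v3. distinct [v0, v1, v2, v3] \<Longrightarrow>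
       v0 \<in> B i0 \<inter> B i1 \<Longrightarrow> v1 \<in> B i1 \<inter> B i2 \<Longrightarrow> v2 \<in> B i2 \<inter> B i3 \<Longrightarrow> v3 \<in> B i3 \<inter> B i0 \<Longrightarrow>
       i0 = i1 \<and> i1 = i2 \<and> i2 = i3"
    and e: "{e0, e1, e2, e3} \<subseteq> edges (block_hgraph q V I B \<omega>)"
    and x: "x0 \<in> e0 \<inter> e1" "x1 \<in> e1 \<inter> e2" "x2 \<in> e2 \<inter> e3" "x3 \<in> e3 \<inter> e0" "distinct [x0, x1, x2, x3]"
  shows False
proof -
  have ex: "\<exists>i\<in>I. e \<subseteq> B i \<and> (\<forall>x\<in>e. \<forall>y\<in>e. x \<noteq> y \<longrightarrow> parab q (\<omega> i x) (\<omega> i y)) \<and>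
      (\<forall>x\<in>B i. \<forall>y\<in>e. \<omega> i x = \<omega> i y \<longrightarrow> x = y)" if e: "e \<in> edges (block_hgraph q V I B \<omega>)" for e
  proof -
    obtain u v w i where i: "e = {u, v, w}" "i \<in> I" "{u, v, w} \<subseteq> B i" "clean_triangle q (B i) (\<omega> i) u v w"
      using e by (rule block_hgraph_edgeE)
    then have "\<forall>x\<in>e. \<forall>y\<in>e. x \<noteq> y \<longrightarrow> parab q (\<omega> i x) (\<omega> i y)"
      using clean_triangle_parab[OF i(4)] by blast
    moreover have "\<forall>x\<in>B i. \<forall>y\<in>e. \<omega> i x = \<omega> i y \<longrightarrow> x = y"
      using i(4) unfolding i(1) clean_triangle_def by blast
    ultimately show ?thesis
      using i(1-3) by blast
  qed
  obtain i0 where i0: "i0 \<in> I" "e0 \<subseteq> B i0" "\<forall>x\<in>e0. \<forall>y\<in>e0. x \<noteq> y \<longrightarrow> parab q (\<omega> i0 x) (\<omega> i0 y)"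
    "\<forall>x\<in>B i0. \<forall>y\<in>e0. \<omega> i0 x = \<omega> i0 y \<longrightarrow> x = y"
    using ex[of e0] e by auto
  obtain i1 where i1: "i1 \<in> I" "e1 \<subseteq> B i1" "\<forall>x\<in>e1. \<forall>y\<in>e1. x \<noteq> y \<longrightarrow> parab q (\<omega> i1 x) (\<omega> i1 y)"
    "\<forall>x\<in>B i1. \<forall>y\<in>e1. \<omega> i1 x = \<omega> i1 y \<longrightarrow> x = y"
    using ex[of e1] e by auto
  obtain i2 where i2: "i2 \<in> I" "e2 \<subseteq> B i2" "\<forall>x\<in>e2. \<forall>y\<in>e2. x \<noteq> y \<longrightarrow> parab q (\<omega> i2 x) (\<omega> i2 y)"
    using ex[of e2] e by auto
  obtain i3 where i3: "i3 \<in> I" "e3 \<subseteq> B i3" "\<forall>x\<in>e3. \<forall>y\<in>e3. x \<noteq> y \<longrightarrow> parab q (\<omega> i3 x) (\<omega> i3 y)"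
    using ex[of e3] e by auto
  have "i0 = i1 \<and> i1 = i2 \<and> i2 = i3"
    by (rule blocks[of x0 x1 x2 x3]) (use x i0 i1 i2 i3 in auto)
  then have eq: "i1 = i0" "i2 = i0" "i3 = i0"
    by auto
  have ne: "x0 \<noteq> x1" "x1 \<noteq> x2" "x2 \<noteq> x3" "x3 \<noteq> x0" "x0 \<noteq> x2" "x1 \<noteq> x3"
    using x(5) by auto
  have adj: "parab q (\<omega> i0 x0) (\<omega> i0 x1)" "parab q (\<omega> i0 x2) (\<omega> i0 x1)"
    "parab q (\<omega> i0 x2) (\<omega> i0 x3)" "parab q (\<omega> i0 x0) (\<omega> i0 x3)"
    using i0(3) i1(3) i2(3) i3(3) x ne unfolding eq by auto
  have mem: "x0 \<in> B i0" "x1 \<in> B i0" "x2 \<in> B i0" "x3 \<in> B i0"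
    using i0(2) i1(2) i2(2) i3(2) x unfolding eq by auto
  have "\<omega> i0 x0 = \<omega> i0 x2 \<or> \<omega> i0 x1 = \<omega> i0 x3"
    using parab_no_C4[OF q _ _ _ _ adj(1,4,2,3)] mem col[OF i0(1)] by (auto simp: PiE_iff)
  moreover have "\<omega> i0 x2 = \<omega> i0 x0 \<longrightarrow> x2 = x0" "\<omega> i0 x3 = \<omega> i0 x1 \<longrightarrow> x3 = x1"
    using i0(4) i1(4) mem x unfolding eq by auto
  ultimately show False
    using ne by metis
qed

lemma block_hgraph_berge_free:
  assumes "prime q" "\<And>i. i \<in> I \<Longrightarrow> \<omega> i \<in> B i \<rightarrow>\<^sub>E plane q"
    and "\<And>i0 i1 i2 i3 v0 v1 v2 v3. distinct [v0, v1, v2, v3] \<Longrightarrow>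
       v0 \<in> B i0 \<inter> B i1 \<Longrightarrow> v1 \<in> B i1 \<inter> B i2 \<Longrightarrow> v2 \<in> B i2 \<inter> B i3 \<Longrightarrow> v3 \<in> B i3 \<inter> B i0 \<Longrightarrow>
       i0 = i1 \<and> i1 = i2 \<and> i2 = i3"
  shows "\<not> (\<exists>F\<in>berge_family 4. contains_copy (block_hgraph q V I B \<omega>) F)"
proof
  assume "\<exists>F\<in>berge_family 4. contains_copy (block_hgraph q V I B \<omega>) F"
  then obtain e :: "nat \<Rightarrow> nat set" and \<phi>
    where e: "berge_cycle 4 e" and inj: "inj_on \<phi> (\<Union>i<4. e i)"
      and img: "(\<lambda>e. \<phi> ` e) ` (e ` {..<4}) \<subseteq> edges (block_hgraph q V I B \<omega>)"
    by (auto simp: berge_family_def contains_copy_def)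
  from e obtain v where v: "inj_on v {..<4::nat}" "\<And>i. i < 4 \<Longrightarrow> v i \<in> e i \<inter> e (Suc i mod 4)"
    by (auto simp: berge_cycle_def)
  have m: "v 0 \<in> e 0 \<inter> e 1" "v 1 \<in> e 1 \<inter> e 2" "v 2 \<in> e 2 \<inter> e 3" "v 3 \<in> e 3 \<inter> e 0"
  proof -
    have lt: "0 < (4::nat)" "1 < (4::nat)" "2 < (4::nat)" "3 < (4::nat)"
      by simp_all
    have mods: "Suc 0 mod 4 = (1::nat)" "Suc 1 mod 4 = (2::nat)" "Suc 2 mod 4 = (3::nat)" "Suc 3 mod 4 = (0::nat)"
      by simp_all
    show "v 0 \<in> e 0 \<inter> e 1" "v 1 \<in> e 1 \<inter> e 2" "v 2 \<in> e 2 \<inter> e 3" "v 3 \<in> e 3 \<inter> e 0"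
      using v(2)[OF lt(1)] v(2)[OF lt(2)] v(2)[OF lt(3)] v(2)[OF lt(4)] unfolding mods .
  qed
  have mem: "v i \<in> (\<Union>i<4. e i)" if "i < 4" for i
    using v(2)[OF that] that by auto
  have "\<phi> (v i) \<noteq> \<phi> (v j)" if "i < 4" "j < 4" "i \<noteq> j" for i j
  proof -
    have "v i \<noteq> v j"
      using inj_onD[OF v(1), of i j] that by auto
    then show ?thesis
      using inj_onD[OF inj, of "v i" "v j"] mem[OF that(1)] mem[OF that(2)] by auto
  qed
  then have "distinct [\<phi> (v 0), \<phi> (v 1), \<phi> (v 2), \<phi> (v 3)]"
    by simp
  moreover have "{\<phi> ` e 0, \<phi> ` e 1, \<phi> ` e 2, \<phi> ` e 3} \<subseteq> edges (block_hgraph q V I B \<omega>)"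
    using img by auto
  ultimately show False
    using m by (intro block_hgraph_no_closed_chain[OF assms, where ?e0.0 = "\<phi> ` e 0"
        and ?e1.0 = "\<phi> ` e 1" and ?e2.0 = "\<phi> ` e 2" and ?e3.0 = "\<phi> ` e 3" and ?x0.0 = "\<phi> (v 0)"
        and ?x1.0 = "\<phi> (v 1)" and ?x2.0 = "\<phi> (v 2)" and ?x3.0 = "\<phi> (v 3)"]) auto
qed

text \<open>A union bound written as a count: independence of the blocks makes the number of
  colourings missing \<open>S\<close> a product, at most
  \<open>exp (- (\<Sum>i\<in>I. p S i))\<close> of all colourings, and at most
  \<open>card V ^ t\<close> sets occur. The minimum in \<open>p\<close> is the largest
  \<open>r\<close> that \<open>pr_hits_ge\<close> admits.\<close>

lemma exists_colouring_hitting_all: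
  fixes B :: "'i \<Rightarrow> 'a set" and t q :: nat
  defines "p \<equiv> \<lambda>S i. real (min (card (S \<inter> B i) div 3) (q div 2)) ^ 3 / (4 * real q ^ 3)"
  assumes V: "finite V" "V \<noteq> {}" and I: "finite I" "\<And>i. i \<in> I \<Longrightarrow> B i \<subseteq> V"
    and q: "prime q" "q \<ge> 18" "\<And>i. i \<in> I \<Longrightarrow> 24 * card (B i) \<le> q ^ 2"
    and large: "\<And>S. S \<subseteq> V \<Longrightarrow> card S = t \<Longrightarrow> real t * ln (card V) < (\<Sum>i\<in>I. p S i)"
  shows "\<exists>\<omega>. (\<forall>i\<in>I. \<omega> i \<in> B i \<rightarrow>\<^sub>E plane q) \<and>
    (\<forall>S\<subseteq>V. card S = t \<longrightarrow> (\<exists>i\<in>I. hits q (B i) (S \<inter> B i) (\<omega> i)))"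
proof (rule ccontr)
  assume contra: "\<not> ?thesis"
  define coloured where "coloured \<omega> \<longleftrightarrow> (\<forall>i\<in>I. \<omega> i \<in> B i \<rightarrow>\<^sub>E plane q)" for \<omega>
  define hit where "hit \<omega> S \<longleftrightarrow> (\<exists>i\<in>I. hits q (B i) (S \<inter> B i) (\<omega> i))" for \<omega> S
  have contra': "\<not> (\<exists>\<omega>. coloured \<omega> \<and> (\<forall>S\<subseteq>V. card S = t \<longrightarrow> hit \<omega> S))"
    using contra unfolding coloured_def hit_def .
  define C where "C i = B i \<rightarrow>\<^sub>E plane q" for i
  define \<Omega> where "\<Omega> = (\<Pi>\<^sub>E i\<in>I. C i)"
  define Bad where "Bad S = (\<Pi>\<^sub>E i\<in>I. {\<phi> \<in> C i. \<not> hits q (B i) (S \<inter> B i) \<phi>})" for S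
  define \<S> where "\<S> = {S. S \<subseteq> V \<and> card S = t}"
  have finC: "finite (C i)" if "i \<in> I" for i
    using finite_subset[OF I(2)[OF that] V(1)] by (simp add: C_def finite_PiE)
  have C_pos: "card (C i) > 0" if "i \<in> I" for i
    using finite_subset[OF I(2)[OF that] V(1)] prime_gt_0_nat[OF q(1)]
    by (simp add: C_def card_PiE card_plane)
  have fin\<S>: "finite \<S>"
    using V by (auto simp: \<S>_def)
  have \<Omega>_pos: "card \<Omega> > 0"
    using I(1) C_pos by (simp add: \<Omega>_def card_PiE prod_pos)
  have "\<Omega> \<subseteq> (\<Union>S\<in>\<S>. Bad S)"
  proof
    fix \<omega> assume \<omega>: "\<omega> \<in> \<Omega>"
    then have "coloured \<omega>"
      unfolding coloured_def
      by (simp add: \<Omega>_def C_def PiE_iff)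
    then obtain S where S: "S \<subseteq> V" "card S = t" "\<not> hit \<omega> S"
      using contra' by blast
    then have "\<omega> \<in> Bad S"
      using \<omega> by (simp add: Bad_def \<Omega>_def PiE_iff hit_def)
    then show "\<omega> \<in> (\<Union>S\<in>\<S>. Bad S)"
      using S by (intro UN_I[of S]) (simp_all add: \<S>_def)
  qed
  then have "card \<Omega> \<le> card (\<Union>S\<in>\<S>. Bad S)"
    using fin\<S> I(1) finC by (intro card_mono finite_UN_I) (simp_all add: Bad_def finite_PiE)
  also have "\<dots> \<le> (\<Sum>S\<in>\<S>. card (Bad S))"
    by (rule card_UN_le[OF fin\<S>])
  finally have "real (card \<Omega>) \<le> (\<Sum>S\<in>\<S>. real (card (Bad S)))"
    by (simp flip: of_nat_sum)
  have bad: "real (card (Bad S)) < exp (- (real t * ln (card V))) * real (card \<Omega>)" if S: "S \<in> \<S>" for S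
  proof -
    have miss: "real (card {\<phi> \<in> C i. \<not> hits q (B i) (S \<inter> B i) \<phi>}) \<le> exp (- p S i) * real (card (C i))"
      if i: "i \<in> I" for i
    proof -
      interpret random_colouring q "B i"
        using q i I(2)[OF i] V(1) by unfold_locales (auto intro: finite_subset)
      have "3 * min (card (S \<inter> B i) div 3) (q div 2) \<le> card (S \<inter> B i)"
        using div_times_less_eq_dividend[of "card (S \<inter> B i)" 3] by linarith
      then have "p S i \<le> pr (hits q (B i) (S \<inter> B i))"
        unfolding p_def by (intro pr_hits_ge) auto
      then have "p S i * real (card (C i)) \<le> real (card {\<phi> \<in> C i. hits q (B i) (S \<inter> B i) \<phi>})"
        using C_pos[OF i] by (simp add: pr_def colourings_def field_simps flip: C_def)
      moreover have "card (C i) = card {\<phi> \<in> C i. hits q (B i) (S \<inter> B i) \<phi>} +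
          card {\<phi> \<in> C i. \<not> hits q (B i) (S \<inter> B i) \<phi>}"
        using finC[OF i] by (subst card_Un_disjoint[symmetric]) (auto intro: arg_cong[of _ _ card])
      ultimately have "real (card {\<phi> \<in> C i. \<not> hits q (B i) (S \<inter> B i) \<phi>}) \<le> (1 - p S i) * real (card (C i))"
        by (simp add: algebra_simps)
      also have "\<dots> \<le> exp (- p S i) * real (card (C i))"
        using exp_ge_add_one_self[of "- p S i"] by (intro mult_right_mono) auto
      finally show ?thesis .
    qed
    have "real (card (Bad S)) = (\<Prod>i\<in>I. real (card {\<phi> \<in> C i. \<not> hits q (B i) (S \<inter> B i) \<phi>}))"
      using I(1) by (simp add: Bad_def card_PiE)
    also have "\<dots> \<le> (\<Prod>i\<in>I. exp (- p S i) * real (card (C i)))"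
      using miss by (intro prod_mono) auto
    also have "\<dots> = exp (- (\<Sum>i\<in>I. p S i)) * real (card \<Omega>)"
      using I(1) by (simp add: prod.distrib exp_sum \<Omega>_def card_PiE flip: sum_negf)
    also have "\<dots> < exp (- (real t * ln (card V))) * real (card \<Omega>)"
      using large[of S] S \<Omega>_pos by (intro mult_strict_right_mono) (auto simp: \<S>_def)
    finally show ?thesis .
  qed
  have "\<S> \<noteq> {}"
    using \<open>real (card \<Omega>) \<le> (\<Sum>S\<in>\<S>. real (card (Bad S)))\<close> \<Omega>_pos by auto
  have "(\<Sum>S\<in>\<S>. real (card (Bad S))) < (\<Sum>S\<in>\<S>. exp (- (real t * ln (card V))) * real (card \<Omega>))"
    by (rule sum_strict_mono[OF fin\<S> \<open>\<S> \<noteq> {}\<close> bad])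
  also have "\<dots> = real (card \<S>) * exp (- (real t * ln (card V))) * real (card \<Omega>)"
    by simp
  also have "\<dots> \<le> real (card V ^ t) * exp (- (real t * ln (card V))) * real (card \<Omega>)"
  proof -
    obtain S where "S \<subseteq> V" "card S = t"
      using \<open>\<S> \<noteq> {}\<close> by (auto simp: \<S>_def)
    then have "t \<le> card V"
      using V(1) card_mono by blast
    then have "card \<S> \<le> card V ^ t"
      using n_subsets[OF V(1), of t] by (simp add: \<S>_def binomial_le_pow)
    then have "real (card \<S>) \<le> real (card V ^ t)"
      by (simp only: of_nat_le_iff)
    then show ?thesis
      by (intro mult_right_mono) auto
  qed
  also have "real (card V ^ t) = exp (real t * ln (card V))"
    using V by (simp add: exp_of_nat_mult card_gt_0_iff)
  also have "exp (real t * ln (card V)) * exp (- (real t * ln (card V))) * real (card \<Omega>) = real (card \<Omega>)"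
    by (simp flip: exp_add)
  finally show False
    using \<open>real (card \<Omega>) \<le> (\<Sum>S\<in>\<S>. real (card (Bad S)))\<close> by simp
qed

text \<open>A capped cubic lies above a line through the origin only on a middle range of
  \<open>s\<close>. At the lower end, \<open>b\<close> gives
  \<open>s ^ 2 * m \<ge> 3456 * q ^ 3 * ln N\<close>, where \<open>3456 = 4 * 4 * 6 ^ 3\<close> and
  \<open>221184 = 64 * 3456\<close>. At the upper end the line reaches \<open>1 / 256\<close>, the
  bound for the capped value, whence \<open>1024 = 4 * 256\<close>.\<close>

lemma block_hit_ge_linear:
  fixes s m q N t :: nat
  assumes pos: "m > 0" "q \<ge> 2" "N \<ge> 2"
    and s: "t * m \<le> 8 * N * s" "real s * (1024 * ln N) \<le> m"
    and a: "32 * N \<le> t * m" and b: "221184 * real N ^ 2 * real q ^ 3 * ln N \<le> real t ^ 2 * real m ^ 3"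
  shows "4 * ln N / m * s \<le> real (min (s div 3) (q div 2)) ^ 3 / (4 * real q ^ 3)"
proof (cases "s div 3 \<le> q div 2")
  case True
  have "(8 * N) * 4 \<le> (8 * N) * s"
    using a s(1) by linarith
  then have "s \<ge> 4"
    using pos(3) by (simp only: mult_le_cancel1)
  then have "real (s div 3) \<ge> real s / 6"
    by linarith
  then have "(real s / 6) ^ 3 \<le> real (s div 3) ^ 3"
    by (intro power_mono) auto
  then have "(real s / 6) ^ 3 / (4 * real q ^ 3) \<le> real (s div 3) ^ 3 / (4 * real q ^ 3)"
    by (intro divide_right_mono) auto
  moreover have "4 * ln N / m * s \<le> (real s / 6) ^ 3 / (4 * real q ^ 3)"
  proof -
    have "real (t * m) \<le> real (8 * N * s)"
      using s(1) by (simp only: of_nat_le_iff)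
    then have "(real t * real m) ^ 2 \<le> (8 * real N * real s) ^ 2"
      by (intro power_mono) auto
    then have "(real t * real m) ^ 2 * real m \<le> (8 * real N * real s) ^ 2 * real m"
      by (intro mult_right_mono) auto
    then have "221184 * real N ^ 2 * real q ^ 3 * ln N \<le> (8 * real N * real s) ^ 2 * real m"
      using b by (simp add: power2_eq_square power3_eq_cube mult_ac)
    then have "real N ^ 2 * (3456 * real q ^ 3 * ln N) \<le> real N ^ 2 * (real s ^ 2 * real m)"
      by (simp add: power_mult_distrib mult_ac)
    then have "3456 * real q ^ 3 * ln N \<le> real s ^ 2 * real m"
      using pos by simp
    then have "real s * (3456 * real q ^ 3 * ln N) \<le> real s * (real s ^ 2 * real m)"
      by (intro mult_left_mono) auto
    then show ?thesis
      using pos by (simp add: field_simps power2_eq_square power3_eq_cube)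
  qed
  ultimately show ?thesis
    using True by simp
next
  case False
  have "real (q div 2) \<ge> real q / 4"
    using pos(2) by linarith
  then have "(real q / 4) ^ 3 \<le> real (q div 2) ^ 3"
    by (intro power_mono) auto
  then have "(real q / 4) ^ 3 / (4 * real q ^ 3) \<le> real (q div 2) ^ 3 / (4 * real q ^ 3)"
    by (intro divide_right_mono) auto
  moreover have "(real q / 4) ^ 3 / (4 * real q ^ 3) = 1 / 256"
    using pos(2) by (simp add: power_divide)
  moreover have "4 * ln N / m * s \<le> 1 / 256"
    using s(2) pos(1) by (simp add: field_simps)
  ultimately have "4 * ln N / m * s \<le> real (q div 2) ^ 3 / (4 * real q ^ 3)"
    by linarith
  moreover have "min (s div 3) (q div 2) = q div 2"
    using False by simp
  ultimately show ?thesis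
    by (simp only:)
qed

lemma sum_Un_le:
  fixes f :: "'a \<Rightarrow> real"
  assumes "finite A" "finite B" "\<And>x. 0 \<le> f x"
  shows "sum f (A \<union> B) \<le> sum f A + sum f B"
  using sum.union_inter[OF assms(1,2), of f] sum_nonneg[of "A \<inter> B" f] assms(3) by simp

text \<open>The slope \<open>4 * ln N / m\<close> of the linear bound is chosen so that half of the
  \<open>m * t\<close> incidences already yield \<open>2 * t * ln N\<close>.\<close>

lemma sum_block_hit_gt:
  fixes s :: "'i \<Rightarrow> nat" and m q N t D :: nat
  assumes I: "finite I" "card I \<le> 2 * N" and sum_s: "(\<Sum>i\<in>I. s i) = m * t"
    and pos: "m > 0" "q \<ge> 2" "N \<ge> 2" "t > 0"
    and sparse: "\<And>J. J \<subseteq> I \<Longrightarrow> t + card J < D ^ 4 \<Longrightarrow> (\<Sum>i\<in>J. s i) \<le> 2 * D * (t + card J)"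
    and a: "32 * N \<le> t * m" and b: "221184 * real N ^ 2 * real q ^ 3 * ln N \<le> real t ^ 2 * real m ^ 3"
    and c: "real t * (1 + 1024 * ln N) < real D ^ 4" "8 * real D * (1 + 1024 * ln N) \<le> m"
  shows "real t * ln N < (\<Sum>i\<in>I. real (min (s i div 3) (q div 2)) ^ 3 / (4 * real q ^ 3))"
proof -
  define L where "L = 1024 * ln N"
  define p where "p i = real (min (s i div 3) (q div 2)) ^ 3 / (4 * real q ^ 3)" for i
  have "ln N > 0"
    using pos by simp
  then have "L > 0"
    by (simp add: L_def)
  \<comment> \<open>Blocks in \<open>Big\<close> and \<open>Small\<close> each carry at most a quarter of the incidences: the former by sparsity,
    the latter because there are at most \<open>2N\<close> blocks. On the others the hitting probability dominates a
    linear function of \<open>s\<close>.\<close>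
  define Big where "Big = {i \<in> I. real m < s i * L}"
  define Small where "Small = {i \<in> I. 8 * N * s i < t * m}"
  define Mid where "Mid = I - Big - Small"
  have fin: "finite Big" "finite Small" "finite Mid"
    using I by (auto simp: Big_def Small_def Mid_def)
  have total: "(\<Sum>i\<in>I. real (s i)) = real m * real t"
    using sum_s by (metis of_nat_mult of_nat_sum)
  \<comment> \<open>The trivial count of incidences first gives \<open>card Big \<le> t * L\<close>.
    This is small enough for \<open>sparse\<close> to apply, which then bounds the incidences
    themselves.\<close>
  have big: "(\<Sum>i\<in>Big. real (s i)) \<le> real m * real t / 4"
  proof -
    have "real (card Big) * real m = (\<Sum>i\<in>Big. real m)"
      by simp
    also have "\<dots> \<le> (\<Sum>i\<in>Big. s i * L)"
      by (intro sum_mono) (auto simp: Big_def)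
    also have "\<dots> \<le> (\<Sum>i\<in>I. s i * L)"
      using I \<open>L > 0\<close> by (intro sum_mono2) (auto simp: Big_def)
    also have "\<dots> = (\<Sum>i\<in>I. real (s i)) * L"
      by (rule sum_distrib_right[symmetric])
    also have "\<dots> = (real t * L) * real m"
      by (simp add: total)
    finally have card: "real (card Big) \<le> real t * L"
      using pos by simp
    then have tL: "real (t + card Big) \<le> real t * (1 + L)"
      by (simp add: algebra_simps)
    also have "real t * (1 + L) < real (D ^ 4)"
      using c(1) by (simp add: L_def)
    finally have "t + card Big < D ^ 4"
      by (simp only: of_nat_less_iff)
    then have "(\<Sum>i\<in>Big. s i) \<le> 2 * D * (t + card Big)"
      by (intro sparse) (auto simp: Big_def)
    then have "real (\<Sum>i\<in>Big. s i) \<le> real (2 * D * (t + card Big))"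
      by (simp only: of_nat_le_iff)
    also have "\<dots> \<le> 2 * real D * (real t * (1 + L))"
      using mult_left_mono[OF tL, of "2 * real D"] by simp
    also have "\<dots> = (8 * real D * (1 + L)) * real t / 4"
      by simp
    also have "\<dots> \<le> real m * real t / 4"
      using c(2) by (intro divide_right_mono mult_right_mono) (auto simp: L_def)
    finally show ?thesis
      by simp
  qed
  have small: "(\<Sum>i\<in>Small. real (s i)) \<le> real m * real t / 4"
  proof -
    have "8 * real N * (\<Sum>i\<in>Small. real (s i)) = (\<Sum>i\<in>Small. real (8 * N * s i))"
      by (simp add: sum_distrib_left)
    also have "\<dots> \<le> (\<Sum>i\<in>Small. real (t * m))"
      by (intro sum_mono, simp only: of_nat_le_iff) (simp add: Small_def)
    also have "\<dots> = real (card Small) * real (t * m)"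
      by simp
    also have "\<dots> \<le> real (2 * N) * real (t * m)"
      using card_mono[of I Small] I by (intro mult_right_mono, simp only: of_nat_le_iff) (auto simp: Small_def)
    finally show ?thesis
      using pos by (simp add: field_simps)
  qed
  have "I \<subseteq> Mid \<union> (Big \<union> Small)"
    by (auto simp: Mid_def)
  then have "(\<Sum>i\<in>I. real (s i)) \<le> (\<Sum>i\<in>Mid \<union> (Big \<union> Small). real (s i))"
    using fin by (intro sum_mono2) auto
  also have "\<dots> \<le> (\<Sum>i\<in>Mid. real (s i)) + (\<Sum>i\<in>Big \<union> Small. real (s i))"
    using fin by (intro sum_Un_le) auto
  also have "(\<Sum>i\<in>Big \<union> Small. real (s i)) \<le> (\<Sum>i\<in>Big. real (s i)) + (\<Sum>i\<in>Small. real (s i))"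
    using fin by (intro sum_Un_le) auto
  finally have "real m * real t / 2 \<le> (\<Sum>i\<in>Mid. real (s i))"
    using total big small by simp
  then have "4 * ln N / m * (real m * real t / 2) \<le> 4 * ln N / m * (\<Sum>i\<in>Mid. real (s i))"
    using \<open>ln N > 0\<close> by (intro mult_left_mono) auto
  also have "\<dots> \<le> (\<Sum>i\<in>Mid. p i)"
    unfolding sum_distrib_left p_def
  proof (rule sum_mono)
    fix i assume "i \<in> Mid"
    then have "t * m \<le> 8 * N * s i" "real (s i) * (1024 * ln N) \<le> m"
      by (auto simp: Mid_def Big_def Small_def L_def)
    then show "4 * ln N / m * s i \<le> real (min (s i div 3) (q div 2)) ^ 3 / (4 * real q ^ 3)"
      using pos a b by (intro block_hit_ge_linear[where t = t]) auto
  qed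
  also have "\<dots> \<le> (\<Sum>i\<in>I. p i)"
    using I by (intro sum_mono2) (auto simp: Mid_def p_def)
  finally have "2 * (real t * ln N) \<le> (\<Sum>i\<in>I. p i)"
    using pos by (simp add: field_simps)
  moreover have "0 < real t * ln N"
    using pos \<open>ln N > 0\<close> by simp
  ultimately show ?thesis
    by (simp add: p_def)
qed

section \<open>Ramsey numbers\<close>

lemma complete_4_contains_berge_cycle:
  assumes "card Q = 4" "Q \<subseteq> verts H" "\<And>T. T \<subseteq> Q \<Longrightarrow> card T = 3 \<Longrightarrow> T \<in> edges H"
  shows "\<exists>F\<in>berge_family 4. contains_copy H F"
proof -
  \<comment> \<open>That is, \<open>e i = {i, i + 1, i + 2}\<close> modulo \<open>4\<close>.\<close>
  define e where "e i = {..<4::nat} - {(i + 3) mod 4}" for i :: nat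
  define F :: "nat hgraph" where "F = (\<Union>i<4. e i, e ` {..<4})"
  have sub: "e i \<subseteq> {..<4}" for i
    by (auto simp: e_def)
  have card_e: "card (e i) = 3" for i
    by (simp add: e_def card_Diff_singleton)
  have small: "i = 0 \<or> i = 1 \<or> i = 2 \<or> i = 3" if "i < 4" for i :: nat
    using that by linarith
  have "inj_on e {..<4}"
  proof (rule inj_onI)
    fix i j :: nat assume ij: "i \<in> {..<4}" "j \<in> {..<4}" "e i = e j"
    have "(i + 3) mod 4 \<notin> e i"
      by (simp add: e_def)
    then have "(i + 3) mod 4 \<notin> e j"
      by (simp only: ij(3) not_False_eq_True)
    moreover have "(i + 3) mod 4 < 4"
      by simp
    ultimately have "(i + 3) mod 4 = (j + 3) mod 4"
      unfolding e_def by blast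
    then show "i = j"
      using ij small[of i] small[of j] by auto
  qed
  moreover have "inj_on (\<lambda>i. Suc i mod 4) {..<4}"
  proof (rule inj_onI)
    fix i j :: nat assume "i \<in> {..<4}" "j \<in> {..<4}" "Suc i mod 4 = Suc j mod 4"
    then show "i = j"
      using small[of i] small[of j] by auto
  qed
  moreover have "Suc i mod 4 \<in> e i \<inter> e (Suc i mod 4)" if "i < 4" for i
    using small[OF that] by (auto simp: e_def)
  ultimately have "berge_cycle 4 e"
    unfolding berge_cycle_def by (intro conjI exI[of _ "\<lambda>i. Suc i mod 4"]) auto
  then have F: "F \<in> berge_family 4"
    unfolding berge_family_def F_def using card_e by blast
  have "finite Q"
    using assms(1) by (intro card_ge_0_finite) simp
  then obtain \<phi> where \<phi>: "bij_betw \<phi> {..<4::nat} Q"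
    using assms(1) ex_bij_betw_nat_finite[of Q] by (auto simp: lessThan_atLeast0)
  have "\<phi> ` e i \<in> edges H" for i
  proof (rule assms(3))
    show "\<phi> ` e i \<subseteq> Q"
      using \<phi> sub[of i] by (auto simp: bij_betw_def)
    show "card (\<phi> ` e i) = 3"
      using \<phi> sub[of i] card_e[of i] by (metis bij_betw_def card_image inj_on_subset)
  qed
  moreover have "inj_on \<phi> (verts F)" "\<phi> ` verts F \<subseteq> verts H"
    using \<phi> assms(2) by (auto simp: F_def bij_betw_def e_def intro: inj_on_subset)
  ultimately have "contains_copy H F"
    unfolding contains_copy_def by (intro exI[of _ \<phi>]) (auto simp: F_def)
  with F show ?thesis
    by blast
qed

text \<open>Without this, the \<open>LEAST\<close> in \<open>ramsey_number\<close> could be an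
  unspecified value. A Berge 4-cycle fits on four vertices, so Ramsey's theorem for triples with
  sizes 4 and \<open>t\<close> suffices.\<close>

lemma ramsey_number_forcing_exists:
  "\<exists>n. \<forall>H :: nat hgraph. uniform_hgraph 3 H \<and> card (verts H) = n \<longrightarrow>
     (\<exists>F\<in>berge_family 4. contains_copy H F) \<or> (\<exists>S. independent_set H S \<and> card S = t)"
proof -
  obtain n :: nat where n: "partn_lst {..<n} [4, t] 3"
    using ramsey_full[of "[4, t]" 3] by auto
  have "(\<exists>F\<in>berge_family 4. contains_copy H F) \<or> (\<exists>S. independent_set H S \<and> card S = t)"
    if H: "uniform_hgraph 3 H" "card (verts H) = n" for H :: "nat hgraph"
  proof -
    have "finite (verts H)"
      using H by (simp add: uniform_hgraph_def)
    then obtain g where g: "bij_betw g {..<n} (verts H)"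
      using ex_bij_betw_nat_finite[of "verts H"] H by (auto simp: lessThan_atLeast0)
    define f :: "nat set \<Rightarrow> nat" where "f X = (if g ` X \<in> edges H then 0 else 1)" for X
    have "f \<in> nsets {..<n} 3 \<rightarrow> {..<2}"
      by (auto simp: f_def)
    then obtain i K where iK: "i < length [4, t]" "K \<in> nsets {..<n} ([4, t] ! i)" "f ` nsets K 3 \<subseteq> {i}"
      by (rule partn_lstE[OF n]) auto
    have K: "K \<subseteq> {..<n}" "finite K" "card K = [4, t] ! i"
      using iK(2) by (auto simp: nsets_def)
    have inj: "inj_on g K"
      using g K by (auto simp: bij_betw_def intro: inj_on_subset)
    have gK: "g ` K \<subseteq> verts H" "card (g ` K) = card K"
      using g K card_image[OF inj] by (auto simp: bij_betw_def)
    have triple: "\<exists>X. f X = i \<and> T = g ` X" if T: "T \<subseteq> g ` K" "card T = 3" for T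
    proof -
      obtain X where X: "X \<subseteq> K" "T = g ` X"
        using T(1) by (auto simp: subset_image_iff)
      have "card X = 3"
        using card_image[OF inj_on_subset[OF inj X(1)]] X(2) T(2) by simp
      then have "X \<in> nsets K 3"
        using X(1) K(2) by (auto simp: nsets_def intro: finite_subset)
      then have "f X = i"
        using iK(3) by auto
      then show ?thesis
        using X(2) by blast
    qed
    consider "i = 0" | "i = 1"
      using iK(1) by force
    then show ?thesis
    proof cases
      case 1
      have "\<exists>F\<in>berge_family 4. contains_copy H F"
      proof (intro complete_4_contains_berge_cycle[of "g ` K"])
        fix T assume "T \<subseteq> g ` K" "card T = 3"
        then obtain X where "f X = i" "T = g ` X"
          using triple by blast
        then show "T \<in> edges H"
          using 1 by (simp add: f_def split: if_splits)
      qed (use gK K 1 in auto)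
      then show ?thesis ..
    next
      case 2
      have "\<not> e \<subseteq> g ` K" if e: "e \<in> edges H" for e
      proof
        assume "e \<subseteq> g ` K"
        moreover have "card e = 3"
          using H e by (auto simp: uniform_hgraph_def)
        ultimately obtain X where "f X = i" "e = g ` X"
          using triple by blast
        then show False
          using 2 e by (simp add: f_def)
      qed
      then have "independent_set H (g ` K)"
        unfolding independent_set_def using gK(1) by (intro conjI ballI)
      moreover have "card (g ` K) = t"
        using gK(2) K(3) 2 by simp
      ultimately have "\<exists>S. independent_set H S \<and> card S = t"
        by (intro exI[of _ "g ` K"] conjI)
      then show ?thesis ..
    qed
  qed
  then show ?thesis
    by blast
qed

text \<open>\<open>ramsey_number\<close> speaks of hypergraphs with exactly \<open>n\<close>
  vertices, so a larger \<open>H\<close> has to be restricted to \<open>n\<close> of its vertices;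
  this creates neither copies nor independent sets.\<close>

lemma ramsey_number_gt:
  fixes H :: "nat hgraph"
  assumes H: "uniform_hgraph 3 H" and no_copy: "\<not> (\<exists>F\<in>berge_family 4. contains_copy H F)"
    and no_indep: "\<not> (\<exists>S. independent_set H S \<and> card S = t)"
  shows "card (verts H) < ramsey_number t (berge_family 4)"
proof (rule ccontr)
  define n where "n = ramsey_number t (berge_family 4)"
  have n: "(\<exists>F\<in>berge_family 4. contains_copy H F) \<or> (\<exists>S. independent_set H S \<and> card S = t)"
    if "uniform_hgraph 3 H \<and> card (verts H) = n" for H :: "nat hgraph"
    using LeastI_ex[OF ramsey_number_forcing_exists[of t]] that unfolding n_def ramsey_number_def by blast
  assume "\<not> ?thesis"
  then have "n \<le> card (verts H)"
    by (simp add: n_def)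
  then obtain V where V: "V \<subseteq> verts H" "card V = n" "finite V"
    by (rule obtain_subset_with_card_n)
  define H' :: "nat hgraph" where "H' = (V, {e \<in> edges H. e \<subseteq> V})"
  have "uniform_hgraph 3 H' \<and> card (verts H') = n"
    using H V by (auto simp: H'_def uniform_hgraph_def)
  then consider "\<exists>F\<in>berge_family 4. contains_copy H' F" | "\<exists>S. independent_set H' S \<and> card S = t"
    using n by blast
  then show False
  proof cases
    case 1
    then obtain F \<phi> where F: "F \<in> berge_family 4" "inj_on \<phi> (verts F)" "\<phi> ` verts F \<subseteq> verts H'"
      "(\<lambda>e. \<phi> ` e) ` edges F \<subseteq> edges H'"
      unfolding contains_copy_def by blast
    have sub: "verts H' \<subseteq> verts H" "edges H' \<subseteq> edges H"
      using V(1) by (auto simp: H'_def)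
    have "contains_copy H F"
      unfolding contains_copy_def
      by (intro exI[of _ \<phi>] conjI F(2) order.trans[OF F(3) sub(1)] order.trans[OF F(4) sub(2)])
    then show False
      using no_copy F(1) by blast
  next
    case 2
    then obtain S where "independent_set H' S" "card S = t"
      by blast
    then have S: "S \<subseteq> V" "\<forall>e\<in>edges H. e \<subseteq> V \<longrightarrow> \<not> e \<subseteq> S" "card S = t"
      by (simp_all add: independent_set_def H'_def)
    have "S \<subseteq> verts H"
      using S(1) V(1) by (rule order.trans)
    moreover have "\<not> e \<subseteq> S" if "e \<in> edges H" for e
      using S(1,2) that by (meson order.trans)
    ultimately have "independent_set H S"
      by (simp add: independent_set_def)
    then show False
      using S(3) no_indep by blast
  qed
qed

text \<open>The size \<open>N\<close> of the dense subgraph is known only to lie between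
  \<open>m ^ 4\<close> and \<open>n\<close>. The numerical hypotheses are therefore stated for
  \<open>n\<close>, from which they pass down to \<open>N\<close>, and the conclusion uses the lower
  end. The second size \<open>t'\<close> is covered because a large independent set contains one of
  size \<open>t\<close>.\<close>

lemma ramsey_number_gt_of_girth_graph:
  fixes G :: "nat hgraph" and m q t t' D n :: nat
  assumes G: "uniform_hgraph 2 G" "girth G > 8" "card (verts G) = n" "m * n < card (edges G)"
    and m: "m \<ge> 2" and q: "prime q" "q \<ge> 18" "24 * m \<le> q ^ 2" and t: "t > 0" "t \<le> t'"
    and a: "32 * n \<le> t * m" and b: "221184 * real n ^ 2 * real q ^ 3 * ln n \<le> real t ^ 2 * real m ^ 3"
    and c: "real t * (1 + 1024 * ln n) < real D ^ 4" "8 * real D * (1 + 1024 * ln n) \<le> m"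
  shows "m ^ 4 < ramsey_number t' (berge_family 4)"
proof -
  have fin: "finite (verts G)"
    using G(1) by (simp add: uniform_hgraph_def)
  have "{e \<in> edges G. e \<subseteq> verts G} = edges G"
    using G(1) by (auto simp: uniform_hgraph_def)
  then have "m * card (verts G) < card {e \<in> edges G. e \<subseteq> verts G}"
    using G(3,4) by simp
  moreover have "card e = 2" if "e \<in> edges G" for e
    using G(1) that by (simp add: uniform_hgraph_def)
  ultimately obtain W where W': "W \<subseteq> verts G" "W \<noteq> {}" "\<forall>u\<in>W. m < card {v \<in> W. {u, v} \<in> edges G}"
    using exists_subset_min_degree[OF fin, of "edges G" m] by blast
  then have W: "W \<subseteq> verts G" "W \<noteq> {}" "\<And>u. u \<in> W \<Longrightarrow> m < card {v \<in> W. {u, v} \<in> edges G}"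
    by auto
  define N where "N = card W"
  have finW: "finite W"
    using W fin by (auto intro: finite_subset)
  have "m ^ 4 \<le> N"
    unfolding N_def using G by (intro moore_bound[of G] finW W) (simp_all add: numeral_eq_enat)
  moreover have "2 ^ 4 \<le> m ^ 4"
    using m by (intro power_mono) auto
  ultimately have N: "m ^ 4 \<le> N" "N \<ge> 2" "N \<le> n"
    using card_mono[OF fin W(1)] G(3) by (auto simp: N_def)
  have lnN: "0 \<le> ln N" "ln N \<le> ln n"
    using N by (auto simp: ln_le_cancel_iff)
  have m_pos: "m > 0"
    using m by simp
  have deg: "m \<le> card {v \<in> W. {u, v} \<in> edges G}" if "u \<in> W" for u
    using W(3)[OF that] by simp
  obtain I :: "(nat \<times> nat) set" and B where "block_system W m I B"
    using exists_block_system[OF G(1,2) finW m_pos deg] by blast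
  then interpret block_system W m I B .
  have b': "221184 * real N ^ 2 * real q ^ 3 * ln N \<le> real t ^ 2 * real m ^ 3"
  proof -
    have "221184 * real N ^ 2 * real q ^ 3 * ln N \<le> 221184 * real n ^ 2 * real q ^ 3 * ln n"
      using N lnN by (intro mult_mono power_mono) auto
    then show ?thesis
      using b by linarith
  qed
  have c': "real t * (1 + 1024 * ln N) < real D ^ 4" "8 * real D * (1 + 1024 * ln N) \<le> m"
  proof -
    have "real t * (1 + 1024 * ln N) \<le> real t * (1 + 1024 * ln n)"
      using lnN by (intro mult_left_mono) auto
    then show "real t * (1 + 1024 * ln N) < real D ^ 4"
      using c(1) by linarith
    have "8 * real D * (1 + 1024 * ln N) \<le> 8 * real D * (1 + 1024 * ln n)"
      using lnN by (intro mult_left_mono) auto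
    then show "8 * real D * (1 + 1024 * ln N) \<le> m"
      using c(2) by linarith
  qed
  have "\<exists>\<omega>. (\<forall>i\<in>I. \<omega> i \<in> B i \<rightarrow>\<^sub>E plane q) \<and>
      (\<forall>S\<subseteq>W. card S = t \<longrightarrow> (\<exists>i\<in>I. hits q (B i) (S \<inter> B i) (\<omega> i)))"
  proof (rule exists_colouring_hitting_all)
    show "24 * card (B i) \<le> q ^ 2" if "i \<in> I" for i
      using card_block[OF that] q(3) by linarith
    show "real t * ln (card W) <
        (\<Sum>i\<in>I. real (min (card (S \<inter> B i) div 3) (q div 2)) ^ 3 / (4 * real q ^ 3))"
      if S: "S \<subseteq> W" "card S = t" for S
      unfolding N_def[symmetric]
    proof (rule sum_block_hit_gt)
      show "card I \<le> 2 * N" "(\<Sum>i\<in>I. card (S \<inter> B i)) = m * t"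
        using card_I sum_card_block[OF S(1)] S(2) by (simp_all add: N_def)
      show "(\<Sum>i\<in>J. card (S \<inter> B i)) \<le> 2 * D * (t + card J)" if "J \<subseteq> I" "t + card J < D ^ 4" for J
        using sparse[OF S(1) that(1), of D] that S(2) by simp
      show "32 * N \<le> t * m"
        using a N(3) by linarith
    qed (use finite_I m q t(1) N b' c' in auto)
  qed (use finW W(2) finite_I block_subset q in auto)
  then obtain \<omega> where \<omega>: "\<And>i. i \<in> I \<Longrightarrow> \<omega> i \<in> B i \<rightarrow>\<^sub>E plane q"
    and hit: "\<And>S. S \<subseteq> W \<Longrightarrow> card S = t \<Longrightarrow> \<exists>i\<in>I. hits q (B i) (S \<inter> B i) (\<omega> i)"
    by metis
  define H where "H = block_hgraph q W I B \<omega>"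
  have "\<not> (\<exists>S. independent_set H S \<and> card S = t')"
  proof
    assume "\<exists>S. independent_set H S \<and> card S = t'"
    then obtain S' where S': "independent_set H S'" "card S' = t'"
      by auto
    then obtain S where S: "S \<subseteq> S'" "card S = t"
      using obtain_subset_with_card_n[of t S'] t(2) by auto
    have "S' \<subseteq> W"
      using S'(1) by (simp add: independent_set_def H_def block_hgraph_def)
    then have "S \<subseteq> W"
      using S(1) by simp
    then obtain i where i: "i \<in> I" "hits q (B i) (S \<inter> B i) (\<omega> i)"
      using hit[OF _ S(2)] by blast
    then obtain u v w where uvw: "{u, v, w} \<subseteq> S \<inter> B i" "clean_triangle q (B i) (\<omega> i) u v w"
      by (auto simp: hits_def)
    then have "{u, v, w} \<in> edges H"
      using i(1) unfolding H_def block_hgraph_def by auto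
    then show False
      using S'(1) S(1) uvw(1) by (auto simp: independent_set_def)
  qed
  then have "card (verts H) < ramsey_number t' (berge_family 4)"
    unfolding H_def using block_hgraph_berge_free[OF q(1) \<omega> closed_chain_trivial] finW block_subset
    by (intro ramsey_number_gt uniform_block_hgraph) auto
  then show ?thesis
    using N(1) by (simp add: H_def block_hgraph_def N_def)
qed

section \<open>The lower bound\<close>

lemma eventually_ramsey_number_gt:
  assumes "c\<^sub>1 > 0" and G: "\<forall>\<^sub>F n in sequentially. \<exists>G :: nat hgraph.
             uniform_hgraph 2 G \<and> card (verts G) = n \<and> girth G > 8 \<and>
             real (card (edges G)) \<ge> c\<^sub>1 * real n powr (5/4)"
  shows "\<exists>A>0. \<forall>\<^sub>F m in sequentially. \<forall>t. A * real m powr (13/4) * sqrt (ln (real m)) \<le> real t \<longrightarrow>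
           m ^ 4 < ramsey_number t (berge_family 4)"
proof -
  \<comment> \<open>Ensures \<open>n m \<le> K * m ^ 4\<close>: the factor 2 absorbs
    \<open>m + 1\<close>, the summand 1 the rounding in \<open>n\<close>.\<close>
  define K where "K = (2 / c\<^sub>1) ^ 4 + 1"
  have K: "K > 0"
    using assms(1) by (simp add: K_def add_pos_pos)
  \<comment> \<open>\<open>300000 ^ 2\<close> exceeds \<open>221184 * 64000 * 5\<close>, the
    constant that condition \<open>b\<close> produces from the bounds for \<open>q ^ 3\<close> and
    \<open>ln (n m)\<close>.\<close>
  define A where "A = 300000 * K"
  have A: "A > 0"
    using K by (simp add: A_def)
  \<comment> \<open>Makes \<open>c\<^sub>1 * n powr (1/4)\<close> at least \<open>m + 1\<close>, so
    there are at least \<open>(m + 1) * n\<close> edges; the surplus \<open>n\<close> gives the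
    strict bound needed to extract minimum degree above \<open>m\<close>.\<close>
  define n where "n m = nat \<lceil>((real m + 1) / c\<^sub>1) ^ 4\<rceil>" for m
  define \<tau> where "\<tau> m = A * real m powr (13/4) * sqrt (ln (real m))" for m :: nat
  \<comment> \<open>\<open>D ^ 4\<close> has to exceed \<open>m powr (13/4)\<close> by a power of
    \<open>ln m\<close>, and \<open>D * ln m\<close> has to stay below \<open>m\<close>; any
    exponent strictly between 13/16 and 1 would do.\<close>
  define D where "D m = nat \<lfloor>real m powr (7/8)\<rfloor>" for m :: nat
  \<comment> \<open>A prime in \<open>(x, 4 * x]\<close> satisfies \<open>24 * m \<le> q ^ 2\<close>
    and is still of order \<open>sqrt m\<close>.\<close>
  define x where "x m = nat \<lceil>sqrt (24 * real m)\<rceil>" for m :: nat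
  have "filterlim n at_top sequentially"
    unfolding n_def using assms(1) by real_asymp
  then have evG: "\<forall>\<^sub>F m in sequentially. \<exists>G :: nat hgraph.
             uniform_hgraph 2 G \<and> card (verts G) = n m \<and> girth G > 8 \<and>
             real (card (edges G)) \<ge> c\<^sub>1 * real (n m) powr (5/4)"
    by (rule eventually_compose_filterlim[OF G])
  have "filterlim x at_top sequentially"
    unfolding x_def by real_asymp
  then have evp: "\<forall>\<^sub>F m in sequentially. \<exists>p. prime p \<and> x m < p \<and> p \<le> 4 * x m"
    by (rule eventually_compose_filterlim[OF eventually_prime_between])
  have ev1: "\<forall>\<^sub>F m::nat in sequentially. 32 * (K * real m ^ 4) \<le> \<tau> m * real m"
    unfolding \<tau>_def using K A by real_asymp
  have ev2: "\<forall>\<^sub>F m::nat in sequentially. ln (K * real m ^ 4) \<le> 5 * ln (real m)"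
    using K by real_asymp
  have ev3: "\<forall>\<^sub>F m::nat in sequentially.
      (\<tau> m + 1) * (1 + 1024 * (5 * ln (real m))) < (real m powr (7/8) - 1) ^ 4"
    unfolding \<tau>_def using A by real_asymp
  have ev4: "\<forall>\<^sub>F m::nat in sequentially. 8 * real m powr (7/8) * (1 + 1024 * (5 * ln (real m))) \<le> real m"
    by real_asymp
  have "\<forall>\<^sub>F m in sequentially. \<forall>t. \<tau> m \<le> real t \<longrightarrow> m ^ 4 < ramsey_number t (berge_family 4)"
    \<comment> \<open>From \<open>m \<ge> 14\<close> on, \<open>24 * m \<ge> 18 ^ 2\<close>, which
      gives \<open>q \<ge> 18\<close>.\<close>
    using evG evp ev1 ev2 ev3 ev4 eventually_ge_at_top[of 14]
  proof eventually_elim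
    case (elim m)
    obtain G :: "nat hgraph" where G: "uniform_hgraph 2 G" "card (verts G) = n m" "girth G > 8"
      and edges: "real (card (edges G)) \<ge> c\<^sub>1 * real (n m) powr (5/4)"
      using elim(1) by blast
    obtain q where q: "prime q" "x m < q" "q \<le> 4 * x m"
      using elim(2) by blast
    have m: "m \<ge> 14"
      by (fact elim(7))
    have n_ge: "((real m + 1) / c\<^sub>1) ^ 4 \<le> real (n m)"
      unfolding n_def by linarith
    have n_pos: "n m > 0"
    proof -
      have "0 < ((real m + 1) / c\<^sub>1) ^ 4"
        using assms(1) by simp
      then have "0 < real (n m)"
        using n_ge by linarith
      then show ?thesis
        by simp
    qed
    have n_le: "real (n m) \<le> K * real m ^ 4"
    proof -
      have "real (n m) \<le> ((real m + 1) / c\<^sub>1) ^ 4 + 1"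
        unfolding n_def using assms(1) by (simp add: of_nat_nat)
      also have "\<dots> \<le> (2 / c\<^sub>1 * real m) ^ 4 + real m ^ 4"
        using assms(1) m by (intro add_mono power_mono one_le_power) (auto simp: field_simps)
      also have "\<dots> = K * real m ^ 4"
        by (simp only: K_def distrib_right power_mult_distrib mult_1)
      finally show ?thesis .
    qed
    have "m * n m < card (edges G)"
    proof -
      define z where "z = (real m + 1) / c\<^sub>1"
      have "z > 0"
        using assms(1) by (simp add: z_def)
      have "(z powr 4) powr (1/4) = z"
        using \<open>z > 0\<close> by (simp only: powr_powr) simp
      then have "z = (z ^ 4) powr (1/4)"
        using \<open>z > 0\<close> by simp
      also have "\<dots> \<le> real (n m) powr (1/4)"
        using n_ge by (intro powr_mono2) (auto simp: z_def)
      finally have "real m + 1 \<le> c\<^sub>1 * real (n m) powr (1/4)"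
        using assms(1) by (simp add: z_def field_simps)
      then have "(real m + 1) * real (n m) \<le> c\<^sub>1 * real (n m) powr (1/4) * real (n m)"
        by (intro mult_right_mono) auto
      also have "\<dots> = c\<^sub>1 * real (n m) powr (5/4)"
        using n_pos powr_add[of "real (n m)" "1/4" 1] by simp
      also have "\<dots> \<le> real (card (edges G))"
        by (fact edges)
      finally have "real m * real (n m) + real (n m) \<le> real (card (edges G))"
        by (simp add: algebra_simps)
      then have "real (m * n m) < real (card (edges G))"
        using n_pos by simp
      then show ?thesis
        by (simp only: of_nat_less_iff)
    qed
    have x_ge: "sqrt (24 * real m) \<le> real (x m)"
      unfolding x_def by linarith
    have q_sq: "24 * m \<le> q ^ 2"
    proof -
      have "sqrt (24 * real m) \<le> real q"
        using x_ge q(2) by linarith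
      then have "24 * real m \<le> real q ^ 2"
        by (simp add: real_le_lsqrt sqrt_le_D)
      then have "real (24 * m) \<le> real (q ^ 2)"
        by simp
      then show ?thesis
        by (simp only: of_nat_le_iff)
    qed
    have "18 \<le> sqrt (24 * real m)"
      using m by (intro real_le_rsqrt) simp
    then have q18: "q \<ge> 18"
      using x_ge q(2) by linarith
    have q_le: "real q \<le> 40 * sqrt (real m)"
    proof -
      have "real (x m) \<le> sqrt (24 * real m) + 1"
        unfolding x_def using real_sqrt_ge_zero[of "24 * real m"] by linarith
      moreover have "sqrt (24 * real m) \<le> 5 * sqrt (real m)"
        by (rule real_le_lsqrt) (auto simp: power_mult_distrib)
      moreover have "1 \<le> sqrt (real m)"
        using m by simp
      ultimately show ?thesis
        using q(3) by linarith
    qed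
    have q3: "real q ^ 3 \<le> 64000 * real m powr (3/2)"
    proof -
      have "real q ^ 3 \<le> (40 * sqrt (real m)) ^ 3"
        using q_le by (intro power_mono) auto
      also have "\<dots> = 64000 * real m powr (3/2)"
        using m by (simp add: power_mult_distrib powr_half_sqrt[symmetric] powr_power)
      finally show ?thesis .
    qed
    have lnm: "ln (real m) > 0"
      using m by simp
    have ln_n: "ln (n m) \<le> 5 * ln (real m)"
    proof -
      have "ln (n m) \<le> ln (K * real m ^ 4)"
        using n_pos n_le K m by (subst ln_le_cancel_iff) auto
      then show ?thesis
        using elim(4) by linarith
    qed
    have ln_n0: "0 \<le> ln (n m)"
      using n_pos by simp
    define t where "t = nat \<lceil>\<tau> m\<rceil>"
    have \<tau>: "\<tau> m > 0"
      using A m lnm by (simp add: \<tau>_def)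
    have t: "\<tau> m \<le> real t" "real t \<le> \<tau> m + 1" "t > 0"
      using \<tau> unfolding t_def by linarith+
    have D_le: "real (D m) \<le> real m powr (7/8)"
      unfolding D_def by simp
    have D_ge: "real m powr (7/8) - 1 \<le> real (D m)"
      unfolding D_def by linarith
    have a: "32 * n m \<le> t * m"
    proof -
      have "32 * real (n m) \<le> 32 * (K * real m ^ 4)"
        using n_le by simp
      also have "\<dots> \<le> \<tau> m * real m"
        by (fact elim(3))
      also have "\<dots> \<le> real t * real m"
        using t(1) by (intro mult_right_mono) auto
      finally have "real (32 * n m) \<le> real (t * m)"
        by simp
      then show ?thesis
        by (simp only: of_nat_le_iff)
    qed
    have b: "221184 * real (n m) ^ 2 * real q ^ 3 * ln (n m) \<le> real t ^ 2 * real m ^ 3"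
    proof -
      have "221184 * real (n m) ^ 2 * real q ^ 3 * ln (n m) \<le>
          221184 * (K * real m ^ 4) ^ 2 * (64000 * real m powr (3/2)) * (5 * ln (real m))"
        using n_le q3 ln_n ln_n0 K by (intro mult_mono power_mono) auto
      also have "\<dots> = 70778880000 * K ^ 2 * (real m ^ 8 * real m powr (3/2)) * ln (real m)"
        by (simp add: power_mult_distrib flip: power_mult)
      also have "\<dots> \<le> A ^ 2 * (real m ^ 8 * real m powr (3/2)) * ln (real m)"
        using lnm by (intro mult_right_mono) (auto simp: A_def power_mult_distrib)
      also have "real m ^ 8 * real m powr (3/2) = (real m powr (13/4)) ^ 2 * real m ^ 3"
      proof -
        have pw: "real m ^ 8 = real m powr 8" "real m ^ 3 = real m powr 3"
            "(real m powr (13/4)) ^ 2 = real m powr (13/2)"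
          using m by (simp_all add: powr_power)
        show ?thesis
          unfolding pw powr_add[symmetric] by simp
      qed
      also have "A ^ 2 * ((real m powr (13/4)) ^ 2 * real m ^ 3) * ln (real m) = \<tau> m ^ 2 * real m ^ 3"
        using lnm by (simp add: \<tau>_def power_mult_distrib)
      also have "\<dots> \<le> real t ^ 2 * real m ^ 3"
        using t(1) \<tau> by (intro mult_right_mono power_mono) auto
      finally show ?thesis .
    qed
    have c1: "real t * (1 + 1024 * ln (n m)) < real (D m) ^ 4"
    proof -
      have "real t * (1 + 1024 * ln (n m)) \<le> (\<tau> m + 1) * (1 + 1024 * (5 * ln (real m)))"
        using t(2) ln_n ln_n0 \<tau> by (intro mult_mono) auto
      also have "\<dots> < (real m powr (7/8) - 1) ^ 4"
        by (fact elim(5))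
      also have "\<dots> \<le> real (D m) ^ 4"
        using D_ge m by (intro power_mono) (auto simp: ge_one_powr_ge_zero)
      finally show ?thesis .
    qed
    have c2: "8 * real (D m) * (1 + 1024 * ln (n m)) \<le> m"
    proof -
      have "8 * real (D m) * (1 + 1024 * ln (n m)) \<le> 8 * real m powr (7/8) * (1 + 1024 * (5 * ln (real m)))"
        using D_le ln_n ln_n0 by (intro mult_mono) auto
      then show ?thesis
        using elim(6) by linarith
    qed
    show ?case
    proof (intro allI impI)
      fix t' assume "\<tau> m \<le> real t'"
      then have "t \<le> t'"
        unfolding t_def by linarith
      then show "m ^ 4 < ramsey_number t' (berge_family 4)"
        using \<open>m * n m < card (edges G)\<close> m
        by (intro ramsey_number_gt_of_girth_graph[OF G(1,3,2) _ _ q(1) q18 q_sq t(3) _ a b c1 c2]) auto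
    qed
  qed
  then show ?thesis
    using A unfolding \<tau>_def by blast
qed

text \<open>For given \<open>t\<close> the relation between \<open>t\<close> and \<open>m\<close> is
  inverted by \<open>m\<close> about \<open>y powr (4/13)\<close>, where \<open>ln t\<close>
  replaces \<open>ln m\<close>; this is admissible since \<open>m \<le> t\<close>, and it costs only
  a constant. Then \<open>m ^ 4\<close> is of order \<open>y powr (16/13)\<close>.\<close>

theorem theorem3:
  assumes "\<exists>c\<^sub>1>0. \<forall>\<^sub>F n in sequentially. \<exists>G :: nat hgraph.
             uniform_hgraph 2 G \<and> card (verts G) = n \<and> girth G > 8 \<and>
             real (card (edges G)) \<ge> c\<^sub>1 * real n powr (5/4)"
  shows "\<exists>c\<^sub>2>0. \<forall>\<^sub>F t in sequentially.
           real (ramsey_number t (berge_family 4)) \<ge> (c\<^sub>2 * real t / sqrt (ln (real t))) powr (16/13)"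
proof -
  obtain A where A: "A > 0"
    and ev: "\<forall>\<^sub>F m in sequentially. \<forall>t. A * real m powr (13/4) * sqrt (ln (real m)) \<le> real t \<longrightarrow>
           m ^ 4 < ramsey_number t (berge_family 4)"
    using eventually_ramsey_number_gt assms by blast
  define y where "y t = real t / (A * sqrt (ln (real t)))" for t :: nat
  define m where "m t = nat \<lfloor>y t powr (4/13)\<rfloor>" for t
  have "filterlim m at_top sequentially"
    unfolding m_def y_def using A by real_asymp
  then have ev_m: "\<forall>\<^sub>F t in sequentially. \<forall>t'. A * real (m t) powr (13/4) * sqrt (ln (real (m t))) \<le> real t' \<longrightarrow>
           m t ^ 4 < ramsey_number t' (berge_family 4)"
    by (rule eventually_compose_filterlim[OF ev])
  have ev_y: "\<forall>\<^sub>F t in sequentially. 1 \<le> y t" "\<forall>\<^sub>F t in sequentially. y t \<le> real t"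
    unfolding y_def using A by real_asymp+
  have "\<forall>\<^sub>F t in sequentially.
      real (ramsey_number t (berge_family 4)) \<ge> (1 / (16 * A) * real t / sqrt (ln (real t))) powr (16/13)"
    using ev_m ev_y eventually_ge_at_top[of 3]
  proof eventually_elim
    case (elim t)
    have lnt: "ln (real t) > 0"
      using elim(4) by simp
    have z1: "1 \<le> y t powr (4/13)"
      using elim(2) by (intro ge_one_powr_ge_zero) auto
    have m_le: "real (m t) \<le> y t powr (4/13)"
      unfolding m_def by simp
    have m_eq: "real (m t) = of_int \<lfloor>y t powr (4/13)\<rfloor>"
      unfolding m_def using z1 by simp
    have "1 \<le> \<lfloor>y t powr (4/13)\<rfloor>"
      using z1 by (simp add: le_floor_iff)
    then have m1: "1 \<le> real (m t)"
      unfolding m_eq by simp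
    have "y t powr (4/13) < real (m t) + 1"
      unfolding m_eq by linarith
    then have m_ge: "y t powr (4/13) / 2 \<le> real (m t)"
      using m1 by linarith
    have "real (m t) powr (13/4) \<le> (y t powr (4/13)) powr (13/4)"
      using m_le by (intro powr_mono2) auto
    also have "\<dots> = y t"
      using elim(2) by (simp add: powr_powr)
    finally have m_y: "real (m t) powr (13/4) \<le> y t" .
    have "y t powr (4/13) \<le> y t powr 1"
      using elim(2) by (intro powr_mono) auto
    then have "real (m t) \<le> real t"
      using m_le elim(2,3) by simp
    then have "sqrt (ln (real (m t))) \<le> sqrt (ln (real t))"
      using m1 elim(4) by (intro real_sqrt_le_mono) (simp add: ln_le_cancel_iff)
    then have "A * real (m t) powr (13/4) * sqrt (ln (real (m t))) \<le> A * y t * sqrt (ln (real t))"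
      using A m_y elim(2) m1 by (intro mult_mono) auto
    also have "\<dots> = real t"
      using A lnt by (simp add: y_def)
    finally have "m t ^ 4 < ramsey_number t (berge_family 4)"
      using elim(1) by blast
    then have "real (m t ^ 4) \<le> real (ramsey_number t (berge_family 4))"
      by (simp only: of_nat_le_iff less_imp_le)
    moreover have "(1 / (16 * A) * real t / sqrt (ln (real t))) powr (16/13) \<le> real (m t ^ 4)"
    proof -
      have "1 / (16 * A) * real t / sqrt (ln (real t)) = 1 / 16 * y t"
        by (simp add: y_def)
      then have "(1 / (16 * A) * real t / sqrt (ln (real t))) powr (16/13) = (1/16) powr (16/13) * y t powr (16/13)"
        using elim(2) by (simp only: powr_mult)
      \<comment> \<open>Rounding down loses at most a factor 2 in \<open>m\<close>, hence 16 in
        \<open>m ^ 4\<close>; this is the 16 in the constant, as \<open>(1/16) powr (16/13)\<close>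
        is at most \<open>1/16\<close>.\<close>
      also have "\<dots> \<le> (1/16) powr 1 * y t powr (16/13)"
        by (intro mult_right_mono powr_mono') auto
      also have "\<dots> = (y t powr (4/13) / 2) ^ 4"
        using elim(2) by (simp add: power_divide powr_power)
      also have "\<dots> \<le> real (m t) ^ 4"
        using m_ge by (intro power_mono) auto
      finally show ?thesis
        by simp
    qed
    ultimately show ?case
      by linarith
  qed
  moreover have "1 / (16 * A) > 0"
    using A by simp
  ultimately show ?thesis
    by blast
qed

end
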